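(* Let $t_0\in\mathbb{R}$, let $p,q:[t_0,+\infty)\to\mathbb{C}$ be continuous functions, and consider the equation $$\phi''(t)+p(t)\phi'(t)+q(t)\phi(t)=0,\qquad t\ge t_0. \quad ( * )$$ Assume that $p$ is continuously differentiable, that $D(t):=2p'(t)+p(t)^2-4q(t)$ is real with $D(t)>0$ for all $t\ge t_0$, and that $D$ is continuously differentiable on $[t_0,+\infty)$. Assume moreover that at least one of the following two groups of conditions holds: (B) $D$ is nondecreasing on $[t_0,+\infty)$, and for some $\varepsilon>0$ the function $\dfrac{D'(t)}{D(t)^{3/2-\varepsilon}}$ is bounded on $[t_0,+\infty)$; (C) there is $\varepsilon>0$ with $D(t)\ge\varepsilon$ for all $t\ge t_0$, the function $\dfrac{D'(t)}{D(t)}$ is bounded on $[t_0,+\infty)$, and $\displaystyle\int_{t_0}^{+\infty}\rho_{D/4}(s)\,\frac{|D'(s)|}{D(s)^{3/2}}\,ds<+\infty$. Let $$r_1(t):=\int_{t_0}^t\bigl[\sqrt{D(\tau)}-\operatorname{Re}p(\tau)\bigr]d\tau-\tfrac12\ln D(t),\qquad t\ge t_0.$$ Then: (i) all solutions of $( * )$ are bounded on $[t_0,+\infty)$ if and only if $r_1$ is bounded from above on $[t_0,+\infty)$; (ii) all solutions $\phi$ of $( * )$ satisfy $\lim_{t\to+\infty}\phi(t)=0$ if and only if $\lim_{t\to+\infty}r_1(t)=-\infty$.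
   Context: For a positive continuously differentiable function $x$ on $[t_0,+\infty)$ and $t_0\le t_1\le t$, define $$R_x(t_1;t):=\frac{1+\sqrt{x(t_0)}(t_1-t_0)}{1+\sqrt{x(t_0)}(t-t_0)}\exp\Bigl\{-\int_{t_1}^t\sqrt{x(s)}\,ds\Bigr\}\sup_{\xi\in[t_0,t_1]}\frac{|(\sqrt{x(\xi)})'|}{\sqrt{x(\xi)}}+\sup_{\xi\in[t_1,t]}\frac{|(\sqrt{x(\xi)})'|}{\sqrt{x(\xi)}},$$ $$\rho_x(t):=\inf_{t_1\in[t_0,t]}R_x(t_1;t),\qquad t\ge t_0.$$ The function $\rho_{D/4}$ is $\rho_x$ for $x=D/4$. Solutions of the equation are complex-valued functions on $[t_0,+\infty)$. *)

theory Defs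
  imports "HOL-Analysis.Analysis"
begin

(* Functions on [t0, +oo) are total functions whose values below t0 are irrelevant;
   accordingly the derivative at t0 itself is the right-hand one. *)

definition ray_deriv :: "real \<Rightarrow> (real \<Rightarrow> 'a::real_normed_vector) \<Rightarrow> real \<Rightarrow> 'a" where
  "ray_deriv t0 f t = vector_derivative f (at t within {t0..})"

(* The library's C1_differentiable_on asks for two-sided derivatives, hence would
   constrain the function to the left of t0. *)
definition C1_on_ray :: "real \<Rightarrow> (real \<Rightarrow> 'a::real_normed_vector) \<Rightarrow> bool" where
  "C1_on_ray t0 f \<longleftrightarrow>
     (\<forall>t\<ge>t0. f differentiable (at t within {t0..})) \<and>
     continuous_on {t0..} (ray_deriv t0 f)"

definition is_solution ::
  "real \<Rightarrow> (real \<Rightarrow> complex) \<Rightarrow> (real \<Rightarrow> complex) \<Rightarrow> (real \<Rightarrow> complex) \<Rightarrow> bool" where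
  "is_solution t0 p q \<phi> \<longleftrightarrow>
     (\<exists>\<phi>' \<phi>''. \<forall>t\<ge>t0.
        (\<phi> has_vector_derivative \<phi>' t) (at t within {t0..}) \<and>
        (\<phi>' has_vector_derivative \<phi>'' t) (at t within {t0..}) \<and>
        \<phi>'' t + p t * \<phi>' t + q t * \<phi> t = 0)"

(* For x positive and C1 on [t0, +oo) and t0 <= t1 <= t, the suprema and the infimum
   below are over nonempty bounded sets of reals, so SUP and INF are the genuine ones. *)

definition R_fun :: "real \<Rightarrow> (real \<Rightarrow> real) \<Rightarrow> real \<Rightarrow> real \<Rightarrow> real" where
  "R_fun t0 x t1 t =
     (1 + sqrt (x t0) * (t1 - t0)) / (1 + sqrt (x t0) * (t - t0))
       * exp (- integral {t1..t} (\<lambda>s. sqrt (x s)))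
       * (SUP \<xi>\<in>{t0..t1}. \<bar>ray_deriv t0 (\<lambda>s. sqrt (x s)) \<xi>\<bar> / sqrt (x \<xi>))
     + (SUP \<xi>\<in>{t1..t}. \<bar>ray_deriv t0 (\<lambda>s. sqrt (x s)) \<xi>\<bar> / sqrt (x \<xi>))"

definition rho :: "real \<Rightarrow> (real \<Rightarrow> real) \<Rightarrow> real \<Rightarrow> real" where
  "rho t0 x t = (INF t1\<in>{t0..t}. R_fun t0 x t1 t)"

definition r1 :: "real \<Rightarrow> (real \<Rightarrow> complex) \<Rightarrow> (real \<Rightarrow> real) \<Rightarrow> real \<Rightarrow> real" where
  "r1 t0 p D t = integral {t0..t} (\<lambda>\<tau>. sqrt (D \<tau>) - Re (p \<tau>)) - 1/2 * ln (D t)"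

definition condition_B :: "real \<Rightarrow> (real \<Rightarrow> real) \<Rightarrow> bool" where
  "condition_B t0 D \<longleftrightarrow>
     mono_on {t0..} D \<and>
     (\<exists>\<epsilon>>0. bounded ((\<lambda>t. ray_deriv t0 D t / D t powr (3/2 - \<epsilon>)) ` {t0..}))"

(* The integrand in the last clause is nonnegative, so Henstock-Kurzweil integrability
   over [t0, +oo) says exactly that the improper integral is finite. *)
definition condition_C :: "real \<Rightarrow> (real \<Rightarrow> real) \<Rightarrow> bool" where
  "condition_C t0 D \<longleftrightarrow>
     (\<exists>\<epsilon>>0. \<forall>t\<ge>t0. D t \<ge> \<epsilon>) \<and>
     bounded ((\<lambda>t. ray_deriv t0 D t / D t) ` {t0..}) \<and>
     (\<lambda>s. rho t0 (\<lambda>t. D t / 4) s * (\<bar>ray_deriv t0 D s\<bar> / D s powr (3/2)))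
       integrable_on {t0..}"

end

theory Submission
  imports Defs
begin

text \<open>The substitution \<open>\<phi> = \<psi> exp (- \<integral> p / 2)\<close> turns the equation into \<open>\<psi>'' = a \<psi>\<close> with the positive
real potential \<open>a = D / 4\<close>. Let \<open>u\<close> be the solution with \<open>u t0 = 1\<close> and \<open>u' t0 = sqrt (a t0)\<close>. It is
positive and nondecreasing, and it dominates every other solution up to a constant, so both claims
are about the single function \<open>G = u exp (- \<integral> Re p / 2)\<close>, the modulus of one solution of the original
equation. What has to be shown is the WKB estimate
\<open>ln u = \<integral> sqrt a - ln a / 4 + O(1)\<close>, because the right-hand side minus \<open>\<integral> Re p / 2\<close> is \<open>r1 / 2\<close> up to
a constant; \<open>2 ln G - r1\<close> is then bounded, and \<open>G\<close> is bounded, or tends to \<open>0\<close>, exactly when \<open>r1\<close> is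
bounded above, or tends to \<open>-\<infinity>\<close>.

Put \<open>s = sqrt a\<close> and let \<open>w = u' / u - s\<close> be the defect of the logarithmic derivative. The Riccati
equation for \<open>u' / u\<close> gives \<open>w' = - w (w + 2 s) - s'\<close>. Dividing by \<open>2 s\<close> expresses the derivative
\<open>w + s' / (2 s)\<close> of \<open>ln u - \<integral> s + ln s / 2\<close> as \<open>- w' / (2 s) - w\<^sup>2 / (2 s)\<close>. Integration by parts
in the first term, and a second identity for \<open>(w / s)\<^sup>2\<close> that controls \<open>\<integral> w\<^sup>2 / s\<close>, show that the estimate
holds as soon as \<open>w / s\<close> is bounded and \<open>\<integral> \<bar>w s'\<bar> / s\<^sup>2 < \<infinity>\<close> (\<open>wkb_growth\<close>). This needs only one
derivative of \<open>a\<close>, whereas the classical WKB remainder involves \<open>a''\<close>.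

The two groups of conditions provide these two facts by comparison arguments for \<open>w\<close>. Under (C) one
has \<open>\<bar>w\<bar> \<le> \<rho>\<close>, and \<open>\<bar>s'\<bar> / s\<^sup>2\<close> is \<open>\<bar>D'\<bar> / D\<^sup>3\<^sup>/\<^sup>2\<close>. Under (B) one has, for some
constants \<open>N \<ge> 0\<close> and \<open>\<delta> > 0\<close>, the bounds
\<open>- N a\<^sup>1\<^sup>/\<^sup>2\<^sup>-\<^sup>\<delta> \<le> 2 w \<le> 0\<close>, so that \<open>\<bar>w s'\<bar> / s\<^sup>2\<close> is dominated by a multiple of
\<open>a' a\<^sup>-\<^sup>1\<^sup>-\<^sup>\<delta>\<close>, which has a bounded primitive.\<close>

section \<open>Calculus on a ray\<close>

lemma at_within_ray:
  fixes t0 :: real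
  assumes "t0 \<le> t" "t < T"
  shows "at t within {t0..T} = at t within {t0..}"
  by (rule at_within_nhd[of _ "{..<T}"]) (use assms in auto)

text \<open>All comparison arguments below are instances of this lemma. The sign condition is stated for
interior points because monotonicity of \<open>a\<close> gives \<open>a' \<ge> 0\<close> directly where the derivative is two-sided.\<close>

lemma ray_deriv_nonneg_imp_mono:
  fixes f :: "real \<Rightarrow> real"
  assumes f: "\<And>t. t0 \<le> t \<Longrightarrow> (f has_real_derivative f' t) (at t within {t0..})"
    and le: "t0 \<le> b" "b \<le> c"
    and nonneg: "\<And>t. b < t \<Longrightarrow> t < c \<Longrightarrow> 0 \<le> f' t"
  shows "f b \<le> f c"
proof (rule DERIV_nonneg_imp_increasing_open[OF le(2)])
  show "continuous_on {b..c} f"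
  proof (rule continuous_on_subset)
    show "continuous_on {t0..} f"
      using f by (intro DERIV_continuous_on[where D = f']) auto
  qed (use le in auto)
next
  fix t assume t: "b < t" "t < c"
  have "at t within {t0..} = at t"
    by (rule at_within_interior) (use t le in auto)
  with f[of t] nonneg[of t] t le show "\<exists>y. DERIV f t :> y \<and> 0 \<le> y" by auto
qed

lemma ray_deriv_le_imp_abs_le:
  fixes f g :: "real \<Rightarrow> real"
  assumes f: "\<And>t. t0 \<le> t \<Longrightarrow> (f has_real_derivative f' t) (at t within {t0..})"
    and g: "\<And>t. t0 \<le> t \<Longrightarrow> (g has_real_derivative g' t) (at t within {t0..})"
    and le: "\<And>t. t0 \<le> t \<Longrightarrow> \<bar>f' t\<bar> \<le> g' t"
    and init: "\<bar>f t0\<bar> \<le> g t0" and t: "t0 \<le> t"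
  shows "\<bar>f t\<bar> \<le> g t"
proof -
  have "g t0 - f t0 \<le> g t - f t"
    by (rule ray_deriv_nonneg_imp_mono[where ?t0.0 = t0 and f = "\<lambda>t. g t - f t" and f' = "\<lambda>t. g' t - f' t"])
      (use f g le t in \<open>force intro!: derivative_intros simp: abs_le_iff\<close>)+
  moreover have "g t0 + f t0 \<le> g t + f t"
  proof (rule ray_deriv_nonneg_imp_mono[where ?t0.0 = t0 and f = "\<lambda>t. g t + f t" and f' = "\<lambda>t. g' t + f' t"])
    fix s assume "t0 < s" then show "0 \<le> g' s + f' s" using le[of s] by auto
  qed (use f g t in \<open>auto intro!: derivative_intros\<close>)
  ultimately show ?thesis using init by auto
qed

lemma integral_has_vector_derivative_ray:
  fixes g :: "real \<Rightarrow> 'a :: banach"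
  assumes "continuous_on {t0..} g" "t0 \<le> t"
  shows "((\<lambda>x. integral {t0..x} g) has_vector_derivative g t) (at t within {t0..})"
  using integral_has_vector_derivative[of t0 "t + 1" g t] assms
    continuous_on_subset[OF assms(1), of "{t0..t + 1}"] at_within_ray[of t0 t "t + 1"]
  by auto

lemma integral_has_real_derivative_ray:
  fixes g :: "real \<Rightarrow> real"
  assumes "continuous_on {t0..} g" "t0 \<le> t"
  shows "((\<lambda>x. integral {t0..x} g) has_real_derivative g t) (at t within {t0..})"
  using integral_has_vector_derivative_ray[OF assms]
  by (simp add: has_real_derivative_iff_has_vector_derivative)

lemma ray_deriv_eq:
  assumes "t0 \<le> t" "(f has_vector_derivative f') (at t within {t0..})"
  shows "ray_deriv t0 f t = f'"
  unfolding ray_deriv_def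
proof (rule vector_derivative_within[OF _ assms(2)])
  show "at t within {t0..} \<noteq> bot"
    using at_within_ray[of t0 t "t + 1"] assms(1) islimpt_Icc[of t0 "t + 1" t]
      trivial_limit_within[of t "{t0..t + 1}"]
    by auto
qed

lemma C1_on_rayD:
  assumes "C1_on_ray t0 f"
  shows "t0 \<le> t \<Longrightarrow> (f has_vector_derivative ray_deriv t0 f t) (at t within {t0..})"
    and "continuous_on {t0..} (ray_deriv t0 f)"
  using assms by (auto simp: C1_on_ray_def ray_deriv_def vector_derivative_works)

section \<open>Existence and positivity for second-order linear equations\<close>

text \<open>The increments of the Picard iteration for \<open>u'' = a u\<close>; the solution is their sum.\<close>

primrec picard_term :: "real \<Rightarrow> (real \<Rightarrow> real) \<Rightarrow> real \<Rightarrow> real \<Rightarrow> nat \<Rightarrow> real \<Rightarrow> real" where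
  "picard_term t0 a \<alpha> \<beta> 0 = (\<lambda>t. \<alpha> + \<beta> * (t - t0))"
| "picard_term t0 a \<alpha> \<beta> (Suc n) =
     (\<lambda>t. integral {t0..t} (\<lambda>r. integral {t0..r} (\<lambda>x. a x * picard_term t0 a \<alpha> \<beta> n x)))"

text \<open>Termwise differentiation for a series whose derivatives decay geometrically relative to a fixed
continuous weight, which may grow arbitrarily fast along the ray: uniform convergence is used only on
the compact interval from \<open>t0\<close> to \<open>t + 1\<close>.\<close>

lemma suminf_has_real_derivative_ray:
  fixes f f' :: "nat \<Rightarrow> real \<Rightarrow> real"
  assumes f: "\<And>n t. t0 \<le> t \<Longrightarrow> (f n has_real_derivative f' n t) (at t within {t0..})"
    and bound: "\<And>n t. t0 \<le> t \<Longrightarrow> \<bar>f' n t\<bar> \<le> (1/2) ^ n * h t"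
    and h: "continuous_on {t0..} h"
    and summ: "\<And>t. t0 \<le> t \<Longrightarrow> summable (\<lambda>n. f n t)"
    and t: "t0 \<le> t"
  shows "((\<lambda>t. \<Sum>n. f n t) has_real_derivative (\<Sum>n. f' n t)) (at t within {t0..})"
proof -
  let ?S = "{t0..t + 1}"
  have "bounded (h ` ?S)"
    by (intro compact_imp_bounded compact_continuous_image continuous_on_subset[OF h]) auto
  then obtain H where H: "\<And>x. x \<in> ?S \<Longrightarrow> \<bar>h x\<bar> \<le> H"
    unfolding bounded_iff by (metis imageI real_norm_def)
  have unif: "uniform_limit ?S (\<lambda>n x. \<Sum>i<n. f' i x) (\<lambda>x. \<Sum>i. f' i x) sequentially"
  proof (rule Weierstrass_m_test)
    fix n x assume x: "x \<in> ?S"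
    have "norm (f' n x) \<le> (1/2) ^ n * h x" using bound x by auto
    also have "\<dots> \<le> (1/2) ^ n * H" by (rule mult_left_mono) (use H[OF x] in auto)
    finally show "norm (f' n x) \<le> (1/2) ^ n * H" .
  qed (intro summable_mult2 summable_geometric, simp)
  have "\<exists>g. \<forall>x\<in>?S. (\<lambda>n. f n x) sums g x \<and>
          (g has_real_derivative (\<Sum>i. f' i x)) (at x within ?S)"
  proof (rule has_field_derivative_series[OF _ _ unif])
    show "(f n has_real_derivative f' n x) (at x within ?S)" if "x \<in> ?S" for n x
      by (rule DERIV_subset[OF f]) (use that in auto)
    show "t0 \<in> ?S" "summable (\<lambda>n. f n t0)" using t summ by auto
  qed simp
  then obtain g where g: "\<And>x. x \<in> ?S \<Longrightarrow> (\<lambda>n. f n x) sums g x"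
    "\<And>x. x \<in> ?S \<Longrightarrow> (g has_real_derivative (\<Sum>i. f' i x)) (at x within ?S)" by blast
  have "((\<lambda>t. \<Sum>n. f n t) has_real_derivative (\<Sum>n. f' n t)) (at t within ?S)"
  proof (rule has_field_derivative_transform_within[where d = 1])
    show "(g has_real_derivative (\<Sum>n. f' n t)) (at t within ?S)" using g(2) t by auto
  qed (use g(1) t in \<open>auto simp: sums_iff dist_real_def\<close>)
  then show ?thesis using at_within_ray[of t0 t "t + 1"] t by simp
qed

text \<open>The weight \<open>h = exp (\<integral> (1 + 2 \<bar>a\<bar>))\<close> satisfies \<open>h' \<ge> 2 \<bar>a\<bar> h\<close> and \<open>h' \<ge> h\<close>. Relative to \<open>h\<close>, integrating
against \<open>a\<close> therefore gains a factor \<open>1/2\<close>, and the second integration loses nothing. Hence the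
Picard increments are at most a multiple of \<open>2\<^sup>-\<^sup>n h\<close> on the whole ray at once, and their sum solves
the equation there without any continuation argument.\<close>

lemma linear_ode_exists:
  fixes a :: "real \<Rightarrow> real"
  assumes a: "continuous_on {t0..} a"
  obtains u v where "u t0 = \<alpha>" "v t0 = \<beta>"
    "\<And>t. t0 \<le> t \<Longrightarrow> (u has_real_derivative v t) (at t within {t0..})"
    "\<And>t. t0 \<le> t \<Longrightarrow> (v has_real_derivative a t * u t) (at t within {t0..})"
proof -
  define U where "U = picard_term t0 a \<alpha> \<beta>"
  \<comment> \<open>\<open>V n\<close> and \<open>V' n\<close> are the first and second derivatives of the \<open>n\<close>-th increment.\<close>
  define V' where "V' n t = (case n of 0 \<Rightarrow> 0 | Suc m \<Rightarrow> a t * U m t)" for n t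
  define V where "V n t = (case n of 0 \<Rightarrow> \<beta> | Suc m \<Rightarrow> integral {t0..t} (\<lambda>x. a x * U m x))" for n t
  define h where "h t = exp (integral {t0..t} (\<lambda>x. 1 + 2 * \<bar>a x\<bar>))" for t
  define C where "C = \<bar>\<alpha>\<bar> + \<bar>\<beta>\<bar>"
  have h_deriv: "(h has_real_derivative h t * (1 + 2 * \<bar>a t\<bar>)) (at t within {t0..})" if "t0 \<le> t" for t
    unfolding h_def using that a
    by (auto intro!: derivative_eq_intros integral_has_real_derivative_ray continuous_intros)
  have h_pos: "0 < h t" for t by (simp add: h_def)
  have h_cont: "continuous_on {t0..} h" using h_deriv by (intro DERIV_continuous_on) auto
  have ha_nonneg: "0 \<le> h t * (2 * \<bar>a t\<bar>)" for t using h_pos[of t] by simp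
  have h_t0: "h t0 = 1" by (simp add: h_def)
  have h_ge: "1 + (t - t0) \<le> h t" if "t0 \<le> t" for t
  proof -
    have h1: "1 \<le> h t" if "t0 \<le> t" for t
      using ray_deriv_nonneg_imp_mono[OF h_deriv, where b = t0 and c = t] h_t0 that h_pos
      by (simp add: less_imp_le)
    have "h t0 - t0 \<le> h t - t"
    proof (rule ray_deriv_nonneg_imp_mono[where ?t0.0 = t0 and f = "\<lambda>t. h t - t" and f' = "\<lambda>t. h t * (1 + 2 * \<bar>a t\<bar>) - 1"])
      fix s assume "t0 < s"
      then show "0 \<le> h s * (1 + 2 * \<bar>a s\<bar>) - 1"
        using h1[of s] ha_nonneg[of s] unfolding distrib_left by linarith
    qed (use h_deriv that in \<open>auto intro!: derivative_intros\<close>)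
    then show ?thesis using h_t0 by simp
  qed
  have V'_Suc: "V' (Suc n) = (\<lambda>t. a t * U n t)" for n by (simp add: V'_def fun_eq_iff)
  have V_Suc: "V (Suc n) = (\<lambda>t. integral {t0..t} (V' (Suc n)))" for n
    by (simp add: V'_Suc V_def fun_eq_iff)
  have U_Suc: "U (Suc n) = (\<lambda>t. integral {t0..t} (V (Suc n)))" for n
    by (simp add: V_Suc V'_Suc U_def)
  have U_cont: "continuous_on {t0..} (U n)" and
    V_deriv: "\<And>t. t0 \<le> t \<Longrightarrow> (V n has_real_derivative V' n t) (at t within {t0..})" and
    U_deriv: "\<And>t. t0 \<le> t \<Longrightarrow> (U n has_real_derivative V n t) (at t within {t0..})" for n
  proof (induction n)
    case 0
    {
      case 1 then show ?case by (auto simp: U_def intro!: continuous_intros)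
    next
      case 2 then show ?case by (auto simp: V'_def V_def intro!: derivative_intros)
    next
      case 3 then show ?case by (auto simp: U_def V_def intro!: derivative_eq_intros)
    }
  next
    case (Suc n)
    have V'c: "continuous_on {t0..} (V' (Suc n))"
      using Suc a by (auto simp: V'_def intro!: continuous_intros)
    have Vd: "(V (Suc n) has_real_derivative V' (Suc n) t) (at t within {t0..})" if "t0 \<le> t" for t
      using integral_has_real_derivative_ray[OF V'c that] by (simp only: V_Suc)
    have Vc: "continuous_on {t0..} (V (Suc n))" using Vd by (intro DERIV_continuous_on) auto
    have Ud: "(U (Suc n) has_real_derivative V (Suc n) t) (at t within {t0..})" if "t0 \<le> t" for t
      using integral_has_real_derivative_ray[OF Vc that] by (simp only: U_Suc)
    {
      case 1 then show ?case using Ud by (intro DERIV_continuous_on) auto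
    next
      case 2 then show ?case by (rule Vd)
    next
      case 3 then show ?case by (rule Ud)
    }
  qed
  have init: "U (Suc n) t0 = 0" "V (Suc n) t0 = 0" for n by (auto simp: U_def V_def)
  have C: "0 \<le> C" by (simp add: C_def)
  have bound: "\<bar>U n t\<bar> \<le> C * (1/2) ^ n * h t \<and> \<bar>V n t\<bar> \<le> C * (1/2) ^ n * h t" if "t0 \<le> t" for n t
    using that
  proof (induction n arbitrary: t)
    case 0
    have "\<bar>U 0 t\<bar> \<le> \<bar>\<alpha>\<bar> + \<bar>\<beta>\<bar> * (t - t0)"
      using 0 abs_triangle_ineq[of \<alpha> "\<beta> * (t - t0)"] by (simp add: U_def abs_mult)
    also have "\<dots> \<le> \<bar>\<alpha>\<bar> * h t + \<bar>\<beta>\<bar> * h t"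
      using mult_left_mono[of 1 "h t" "\<bar>\<alpha>\<bar>"] mult_left_mono[of "t - t0" "h t" "\<bar>\<beta>\<bar>"] h_ge[OF 0] 0
      by auto
    finally have 1: "\<bar>U 0 t\<bar> \<le> C * h t" by (simp add: C_def distrib_right)
    have "\<bar>\<beta>\<bar> * 1 \<le> C * h t"
      by (rule mult_mono) (use h_ge[OF 0] 0 C in \<open>auto simp: C_def\<close>)
    with 1 show ?case by (simp add: V_def)
  next
    case (Suc n)
    let ?c = "C * (1/2) ^ Suc n"
    have c: "0 \<le> ?c" using C by simp
    have G: "((\<lambda>t. ?c * h t) has_real_derivative ?c * (h t * (1 + 2 * \<bar>a t\<bar>))) (at t within {t0..})"
      if "t0 \<le> t" for t using h_deriv[OF that] by (rule DERIV_cmult)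
    have G0: "0 \<le> ?c * h t0" using c h_pos[of t0] by simp
    have V: "\<bar>V (Suc n) t\<bar> \<le> ?c * h t" if "t0 \<le> t" for t
    proof (rule ray_deriv_le_imp_abs_le[OF V_deriv G _ _ that])
      fix r assume r: "t0 \<le> r"
      have "\<bar>V' (Suc n) r\<bar> \<le> \<bar>a r\<bar> * (C * (1/2) ^ n * h r)"
        using Suc.IH[OF r] by (auto simp: V'_def abs_mult intro!: mult_left_mono)
      also have "\<dots> = ?c * (h r * (2 * \<bar>a r\<bar>))" by simp
      also have "\<dots> \<le> ?c * (h r * (1 + 2 * \<bar>a r\<bar>))"
        using h_pos[of r] by (intro mult_left_mono c) auto
      finally show "\<bar>V' (Suc n) r\<bar> \<le> ?c * (h r * (1 + 2 * \<bar>a r\<bar>))" .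
    qed (use G0 init in auto)
    have "\<bar>U (Suc n) t\<bar> \<le> ?c * h t"
    proof (rule ray_deriv_le_imp_abs_le[OF U_deriv G _ _ Suc.prems])
      fix r assume r: "t0 \<le> r"
      have "?c * (h r * 1) \<le> ?c * (h r * (1 + 2 * \<bar>a r\<bar>))"
        using h_pos[of r] by (intro mult_left_mono c) auto
      with V[OF r] show "\<bar>V (Suc n) r\<bar> \<le> ?c * (h r * (1 + 2 * \<bar>a r\<bar>))" by simp
    qed (use G0 init in auto)
    with V Suc.prems show ?case by simp
  qed
  have V'_bound: "\<bar>V' n t\<bar> \<le> (1/2) ^ n * (C * h t * (2 * \<bar>a t\<bar>))" if "t0 \<le> t" for n t
  proof (cases n)
    case 0 then show ?thesis using C h_pos[of t] by (simp add: V'_def)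
  next
    case (Suc m)
    have "\<bar>V' n t\<bar> \<le> \<bar>a t\<bar> * (C * (1/2) ^ m * h t)"
      using bound[OF that] Suc by (auto simp: V'_def abs_mult intro!: mult_left_mono)
    then show ?thesis by (simp add: Suc algebra_simps)
  qed
  have summ: "summable (\<lambda>n. U n t)" "summable (\<lambda>n. V n t)" if "t0 \<le> t" for t
  proof -
    have *: "summable (\<lambda>n. C * (1/2) ^ n * h t)"
      by (intro summable_mult summable_mult2 summable_geometric) simp
    show "summable (\<lambda>n. U n t)"
      by (rule summable_comparison_test'[OF *, of 0]) (use bound[OF that] in auto)
    show "summable (\<lambda>n. V n t)"
      by (rule summable_comparison_test'[OF *, of 0]) (use bound[OF that] in auto)
  qed
  show thesis
  proof (rule that[of "\<lambda>t. \<Sum>n. U n t" "\<lambda>t. \<Sum>n. V n t"])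
    show "(\<Sum>n. U n t0) = \<alpha>"
      using suminf_split_head[OF summ(1)[of t0]] init by (simp add: U_def)
    show "(\<Sum>n. V n t0) = \<beta>"
      using suminf_split_head[OF summ(2)[of t0]] init by (simp add: V_def)
    fix t assume t: "t0 \<le> t"
    show "((\<lambda>t. \<Sum>n. U n t) has_real_derivative (\<Sum>n. V n t)) (at t within {t0..})"
      by (rule suminf_has_real_derivative_ray[where h = "\<lambda>t. C * h t"])
        (use U_deriv bound h_cont summ t in \<open>auto intro!: continuous_intros simp: mult_ac\<close>)
    have "((\<lambda>t. \<Sum>n. V n t) has_real_derivative (\<Sum>n. V' n t)) (at t within {t0..})"
      by (rule suminf_has_real_derivative_ray[where h = "\<lambda>t. C * h t * (2 * \<bar>a t\<bar>)"])
        (use V_deriv V'_bound h_cont a summ t in \<open>auto intro!: continuous_intros\<close>)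
    moreover have "(\<lambda>n. V' (Suc n) t) sums (a t * (\<Sum>n. U n t))"
      unfolding V'_def using summ(1)[OF t] by (auto intro!: sums_mult)
    then have "(\<Sum>n. V' n t) = a t * (\<Sum>n. U n t)"
      by (subst (asm) sums_Suc_iff) (simp add: V'_def sums_iff)
    ultimately show "((\<lambda>t. \<Sum>n. V n t) has_real_derivative a t * (\<Sum>n. U n t)) (at t within {t0..})"
      by simp
  qed
qed

text \<open>The key is that \<open>(u u')' = u'\<^sup>2 + a u\<^sup>2 \<ge> 0\<close>. Hence \<open>u u' \<ge> 0\<close>, so \<open>u\<^sup>2\<close> is nondecreasing and \<open>u\<close> never
vanishes.\<close>

lemma positive_solution:
  fixes u v a :: "real \<Rightarrow> real"
  assumes u: "\<And>t. t0 \<le> t \<Longrightarrow> (u has_real_derivative v t) (at t within {t0..})"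
    and v: "\<And>t. t0 \<le> t \<Longrightarrow> (v has_real_derivative a t * u t) (at t within {t0..})"
    and a: "\<And>t. t0 \<le> t \<Longrightarrow> 0 \<le> a t"
    and init: "0 < u t0" "0 \<le> v t0" and t: "t0 \<le> t"
  shows "0 < u t" "0 \<le> v t"
proof -
  have uv: "0 \<le> u t * v t" if "t0 \<le> t" for t
  proof -
    have "u t0 * v t0 \<le> u t * v t"
    proof (rule ray_deriv_nonneg_imp_mono[where ?t0.0 = t0 and f = "\<lambda>t. u t * v t" and f' = "\<lambda>t. (v t)^2 + a t * (u t)^2"])
      show "((\<lambda>t. u t * v t) has_real_derivative (v r)\<^sup>2 + a r * (u r)\<^sup>2) (at r within {t0..})"
        if "t0 \<le> r" for r
        using u[OF that] v[OF that] by (auto intro!: derivative_eq_intros simp: power2_eq_square)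
    qed (use that a in auto)
    moreover have "0 \<le> u t0 * v t0" using init by simp
    ultimately show ?thesis by simp
  qed
  have nz: "u t \<noteq> 0" if "t0 \<le> t" for t
  proof -
    have "(u t0)^2 \<le> (u t)^2"
      by (rule ray_deriv_nonneg_imp_mono[where ?t0.0 = t0 and f = "\<lambda>t. (u t)^2" and f' = "\<lambda>t. 2 * (u t * v t)"])
        (use that u uv in \<open>auto intro!: derivative_eq_intros\<close>)
    moreover have "0 < (u t0)^2" using init by simp
    ultimately show ?thesis by auto
  qed
  have cont: "continuous_on {t0..t} u"
    using u by (intro continuous_on_subset[OF DERIV_continuous_on[of "{t0..}" u v]]) auto
  show "0 < u t"
  proof (rule ccontr)
    assume "\<not> 0 < u t"
    then obtain r where "t0 \<le> r" "u r = 0"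
      using IVT2'[of u t 0 t0] init t cont by auto
    with nz show False by blast
  qed
  with uv[OF t] show "0 \<le> v t" by (simp add: zero_le_mult_iff)
qed

section \<open>Defect of the logarithmic derivative\<close>

text \<open>The normalisation \<open>v t0 = sqrt (a t0)\<close> makes the defect \<open>w\<close> vanish at \<open>t0\<close>, so that the bounds for \<open>w\<close>
contain no contribution from the initial values.\<close>

locale growing_solution =
  fixes t0 :: real and a a' u v :: "real \<Rightarrow> real"
  assumes a_pos: "t0 \<le> t \<Longrightarrow> 0 < a t"
    and a_deriv: "t0 \<le> t \<Longrightarrow> (a has_real_derivative a' t) (at t within {t0..})"
    and a'_cont: "continuous_on {t0..} a'"
    and u_deriv: "t0 \<le> t \<Longrightarrow> (u has_real_derivative v t) (at t within {t0..})"
    and v_deriv: "t0 \<le> t \<Longrightarrow> (v has_real_derivative a t * u t) (at t within {t0..})"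
    and u_init: "u t0 = 1" and v_init: "v t0 = sqrt (a t0)"
begin

definition s where "s t = sqrt (a t)"
definition s' where "s' t = a' t / (2 * s t)"
definition S where "S t = integral {t0..t} s"
definition w where "w t = v t / u t - s t"

lemma s_pos: "t0 \<le> t \<Longrightarrow> 0 < s t"
  using a_pos by (simp add: s_def)

lemma s_square: "t0 \<le> t \<Longrightarrow> (s t)^2 = a t"
  using a_pos[of t] by (simp add: s_def)

lemma s_deriv: "t0 \<le> t \<Longrightarrow> (s has_real_derivative s' t) (at t within {t0..})"
  unfolding s_def[abs_def] s'_def using a_deriv[of t] a_pos[of t]
  by (auto intro!: derivative_eq_intros simp: field_simps)

lemma s_cont: "continuous_on {t0..} s"
  using s_deriv by (intro DERIV_continuous_on) auto

lemma s'_cont: "continuous_on {t0..} s'"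
  unfolding s'_def using s_pos by (intro continuous_intros a'_cont s_cont) force

lemma S_deriv: "t0 \<le> t \<Longrightarrow> (S has_real_derivative s t) (at t within {t0..})"
  unfolding S_def[abs_def] by (rule integral_has_real_derivative_ray[OF s_cont])

lemma u_pos: "t0 \<le> t \<Longrightarrow> 0 < u t" and v_nonneg: "t0 \<le> t \<Longrightarrow> 0 \<le> v t"
  using positive_solution[OF u_deriv v_deriv less_imp_le[OF a_pos], of t]
  by (simp_all add: u_init v_init a_pos less_imp_le)

lemma w_init: "w t0 = 0" by (simp add: w_def u_init v_init s_def)

lemma w_ge: "t0 \<le> t \<Longrightarrow> - s t \<le> w t"
  using u_pos[of t] v_nonneg[of t] by (simp add: w_def)

lemma w_deriv:
  assumes "t0 \<le> t"
  shows "(w has_real_derivative - w t * (w t + 2 * s t) - s' t) (at t within {t0..})"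
proof -
  have u0: "u t \<noteq> 0" using u_pos[OF assms] by simp
  have "(a t * u t * u t - v t * v t) / (u t * u t) = - w t * (w t + 2 * s t)"
    unfolding s_square[OF assms, symmetric] w_def using u0
    by (simp add: divide_simps) (simp add: algebra_simps power2_eq_square)
  moreover have "(w has_real_derivative (a t * u t * u t - v t * v t) / (u t * u t) - s' t)
      (at t within {t0..})"
    unfolding w_def[abs_def] by (intro DERIV_diff DERIV_divide u_deriv v_deriv s_deriv assms u0)
  ultimately show ?thesis by (simp only:)
qed

lemma w_cont: "continuous_on {t0..} w"
  using w_deriv by (intro DERIV_continuous_on) auto

text \<open>The weight \<open>u exp S\<close> is the integrating factor of \<open>z' = - (w + 2 s) z\<close>: its logarithmic derivative is
\<open>v / u + s = w + 2 s\<close>.\<close>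

lemma gronwall_weighted:
  assumes z: "\<And>t. t0 \<le> t \<Longrightarrow> (z has_real_derivative z' t) (at t within {t0..})"
    and le: "t0 \<le> b" "b \<le> c"
    and z': "\<And>t. b < t \<Longrightarrow> t < c \<Longrightarrow> z' t \<le> - (w t + 2 * s t) * z t"
  shows "z c * (u c * exp (S c)) \<le> z b * (u b * exp (S b))"
proof -
  have E: "((\<lambda>t. u t * exp (S t)) has_real_derivative (w t + 2 * s t) * (u t * exp (S t)))
    (at t within {t0..})" if "t0 \<le> t" for t
    using u_deriv[OF that] S_deriv[OF that] u_pos[OF that]
    by (auto intro!: derivative_eq_intros simp: w_def field_simps)
  have "- (z b * (u b * exp (S b))) \<le> - (z c * (u c * exp (S c)))"
  proof (rule ray_deriv_nonneg_imp_mono[OF _ le, where f = "\<lambda>t. - (z t * (u t * exp (S t)))"])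
    fix t assume "t0 \<le> t"
    then show "((\<lambda>t. - (z t * (u t * exp (S t)))) has_real_derivative
        - (z' t + (w t + 2 * s t) * z t) * (u t * exp (S t))) (at t within {t0..})"
      using DERIV_minus[OF DERIV_mult[OF z[of t] E[of t]]] by (simp add: algebra_simps)
  next
    fix t assume t: "b < t" "t < c"
    then have "0 \<le> - (z' t + (w t + 2 * s t) * z t)" using z'[of t] by (simp add: algebra_simps)
    moreover have "0 \<le> u t * exp (S t)" using u_pos[of t] t le by auto
    ultimately show "0 \<le> - (z' t + (w t + 2 * s t) * z t) * (u t * exp (S t))"
      by (rule mult_nonneg_nonneg)
  qed
  then show ?thesis by simp
qed

text \<open>If \<open>\<bar>s'\<bar> \<le> \<sigma> s\<close>, then the constants \<open>\<sigma>\<close> and \<open>- \<sigma>\<close> are barriers for \<open>w\<close>, since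
\<open>\<bar>s'\<bar> \<le> \<sigma> s \<le> \<sigma> (w + 2 s)\<close>; the excess of \<open>\<bar>w\<bar>\<close> over \<open>\<sigma>\<close> at the left end is damped by the integrating factor.\<close>

lemma w_bound_step:
  assumes le: "t0 \<le> b" "b \<le> c" and \<sigma>: "\<And>t. t \<in> {b..c} \<Longrightarrow> \<bar>s' t\<bar> \<le> \<sigma> * s t"
  shows "\<bar>w c\<bar> \<le> \<sigma> + \<bar>w b\<bar> * (u b / u c * exp (- integral {b..c} s))"
proof -
  have \<sigma>0: "0 \<le> \<sigma>" using \<sigma>[of b] le s_pos[of b]
    by (smt (verit) atLeastAtMost_iff mult_nonneg_nonneg zero_le_mult_iff)
  have S: "S c = S b + integral {b..c} s"
    unfolding S_def using le
    by (subst Henstock_Kurzweil_Integration.integral_combine)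
      (auto intro!: integrable_continuous_real continuous_on_subset[OF s_cont])
  \<comment> \<open>\<open>e = 1\<close> and \<open>e = - 1\<close> give the bounds from above and from below.\<close>
  have up: "e * w c - \<sigma> \<le> \<bar>w b\<bar> * (u b / u c * exp (- integral {b..c} s))" if e: "\<bar>e\<bar> = 1" for e
  proof -
    have "(e * w c - \<sigma>) * (u c * exp (S c)) \<le> (e * w b - \<sigma>) * (u b * exp (S b))"
    proof (rule gronwall_weighted[OF _ le,
        where z' = "\<lambda>t. e * (- w t * (w t + 2 * s t) - s' t)"])
      fix t assume t: "b < t" "t < c"
      have "- (e * s' t) \<le> \<bar>s' t\<bar>" using e by (auto simp: abs_if split: if_splits)
      also have "\<dots> \<le> \<sigma> * s t" using \<sigma> t by auto
      also have "\<dots> \<le> \<sigma> * (w t + 2 * s t)" using w_ge[of t] t le \<sigma>0 by (intro mult_left_mono) auto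
      finally show "e * (- w t * (w t + 2 * s t) - s' t) \<le> - (w t + 2 * s t) * (e * w t - \<sigma>)"
        by (simp add: algebra_simps)
    qed (use w_deriv in \<open>auto intro!: derivative_eq_intros\<close>)
    also have "\<dots> \<le> \<bar>w b\<bar> * (u b * exp (S b))"
      using e \<sigma>0 u_pos[of b] le by (intro mult_right_mono) (auto simp: abs_if split: if_splits)
    finally have "((e * w c - \<sigma>) * (u c * exp (integral {b..c} s))) * exp (S b) \<le> (\<bar>w b\<bar> * u b) * exp (S b)"
      unfolding S exp_add by (simp add: mult_ac)
    then have "(e * w c - \<sigma>) * (u c * exp (integral {b..c} s)) \<le> \<bar>w b\<bar> * u b"
      by simp
    then show ?thesis
      using u_pos[of c] le unfolding exp_minus by (simp add: field_simps)
  qed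
  from up[of 1] up[of "-1"] show ?thesis by (simp add: abs_le_iff)
qed

text \<open>Since \<open>u\<close> is convex and starts along its tangent line \<open>1 + s t0 (t - t0)\<close>, it grows at least as fast
as that line in the sense of logarithmic derivatives. This is where the algebraic factor in the
definition of \<open>\<rho>\<close> comes from.\<close>

lemma u_ratio_le:
  assumes le: "t0 \<le> b" "b \<le> c"
  shows "u b / u c \<le> (1 + s t0 * (b - t0)) / (1 + s t0 * (c - t0))"
proof -
  define k where "k = s t0"
  have k: "0 < k" using s_pos by (simp add: k_def)
  have pos: "0 < 1 + k * (t - t0)" if "t0 \<le> t" for t
    using that k by (intro add_pos_nonneg) auto
  have num: "0 \<le> v t * (1 + k * (t - t0)) - u t * k" if "t0 \<le> t" for t
  proof -
    have "v t0 * (1 + k * (t0 - t0)) - u t0 * k \<le> v t * (1 + k * (t - t0)) - u t * k"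
    proof (rule ray_deriv_nonneg_imp_mono[where f = "\<lambda>t. v t * (1 + k * (t - t0)) - u t * k"
          and f' = "\<lambda>t. a t * u t * (1 + k * (t - t0))"])
      fix r assume "t0 < r"
      then show "0 \<le> a r * u r * (1 + k * (r - t0))"
        using a_pos[of r] u_pos[of r] pos[of r] by simp
    qed (use that v_deriv u_deriv in \<open>auto intro!: derivative_eq_intros simp: algebra_simps\<close>)
    then show ?thesis by (simp add: u_init v_init k_def s_def)
  qed
  have "u b / (1 + k * (b - t0)) \<le> u c / (1 + k * (c - t0))"
  proof (rule ray_deriv_nonneg_imp_mono[OF _ le, where f = "\<lambda>t. u t / (1 + k * (t - t0))"
        and f' = "\<lambda>t. (v t * (1 + k * (t - t0)) - u t * k) / (1 + k * (t - t0))^2"])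
    fix r assume r: "t0 \<le> r"
    show "((\<lambda>t. u t / (1 + k * (t - t0))) has_real_derivative
        (v r * (1 + k * (r - t0)) - u r * k) / (1 + k * (r - t0))\<^sup>2) (at r within {t0..})"
      using u_deriv[OF r] pos[OF r]
      by (auto intro!: derivative_eq_intros simp: power2_eq_square)
  qed (use num le in auto)
  then show ?thesis
    using pos[of b] pos[of c] u_pos[of b] u_pos[of c] le unfolding k_def by (simp add: field_simps)
qed

lemma ray_deriv_sqrt: "t0 \<le> t \<Longrightarrow> ray_deriv t0 (\<lambda>r. sqrt (a r)) t = s' t"
  using ray_deriv_eq[of t0 t s "s' t"] s_deriv[of t]
  by (simp add: has_real_derivative_iff_has_vector_derivative s_def[abs_def])

lemma s'_le_Sup:
  assumes "t0 \<le> b" "t \<in> {b..c}"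
  shows "\<bar>s' t\<bar> \<le> (SUP \<xi>\<in>{b..c}. \<bar>ray_deriv t0 (\<lambda>r. sqrt (a r)) \<xi>\<bar> / sqrt (a \<xi>)) * s t"
proof -
  have eq: "\<bar>ray_deriv t0 (\<lambda>r. sqrt (a r)) \<xi>\<bar> / sqrt (a \<xi>) = \<bar>s' \<xi>\<bar> / s \<xi>" if "\<xi> \<in> {b..c}" for \<xi>
    using that assms ray_deriv_sqrt[of \<xi>] by (simp add: s_def)
  have "continuous_on {b..c} (\<lambda>\<xi>. \<bar>s' \<xi>\<bar> / s \<xi>)"
  proof (rule continuous_on_subset)
    show "continuous_on {t0..} (\<lambda>\<xi>. \<bar>s' \<xi>\<bar> / s \<xi>)"
      using s_pos by (intro continuous_intros s'_cont s_cont) force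
  qed (use assms in auto)
  then have "bdd_above ((\<lambda>\<xi>. \<bar>s' \<xi>\<bar> / s \<xi>) ` {b..c})"
    by (intro bounded_imp_bdd_above compact_imp_bounded compact_continuous_image) auto
  then have "\<bar>s' t\<bar> / s t \<le> (SUP \<xi>\<in>{b..c}. \<bar>s' \<xi>\<bar> / s \<xi>)"
    using assms by (intro cSUP_upper)
  also have "\<dots> = (SUP \<xi>\<in>{b..c}. \<bar>ray_deriv t0 (\<lambda>r. sqrt (a r)) \<xi>\<bar> / sqrt (a \<xi>))"
    by (rule SUP_cong) (simp_all add: eq)
  finally show ?thesis using s_pos[of t] assms by (simp add: field_simps)
qed

text \<open>For each intermediate point \<open>t1\<close>, the barrier estimate on \<open>[t0, t1]\<close> followed by the one on \<open>[t1, t]\<close>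
and the bound for \<open>u t1 / u t\<close> give exactly the expression whose infimum over \<open>t1\<close> is \<open>\<rho>\<close>.\<close>

lemma w_le_rho:
  assumes t: "t0 \<le> t"
  shows "\<bar>w t\<bar> \<le> rho t0 a t"
  unfolding rho_def
proof (rule cINF_greatest)
  fix t1 assume t1: "t1 \<in> {t0..t}"
  define \<sigma>1 where "\<sigma>1 = (SUP \<xi>\<in>{t0..t1}. \<bar>ray_deriv t0 (\<lambda>r. sqrt (a r)) \<xi>\<bar> / sqrt (a \<xi>))"
  define \<sigma>2 where "\<sigma>2 = (SUP \<xi>\<in>{t1..t}. \<bar>ray_deriv t0 (\<lambda>r. sqrt (a r)) \<xi>\<bar> / sqrt (a \<xi>))"
  let ?q = "(1 + s t0 * (t1 - t0)) / (1 + s t0 * (t - t0))" and ?e = "exp (- integral {t1..t} s)"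
  have w1: "\<bar>w t1\<bar> \<le> \<sigma>1"
    using w_bound_step[of t0 t1 \<sigma>1] t1 s'_le_Sup[of t0 _ t1] by (simp add: \<sigma>1_def w_init)
  have "\<bar>w t\<bar> \<le> \<sigma>2 + \<bar>w t1\<bar> * (u t1 / u t * ?e)"
    using w_bound_step[of t1 t \<sigma>2] t1 s'_le_Sup[of t1 _ t] by (simp add: \<sigma>2_def)
  also have "\<bar>w t1\<bar> * (u t1 / u t * ?e) \<le> \<sigma>1 * (?q * ?e)"
    using w1 u_ratio_le[of t1 t] t1 u_pos[of t1] u_pos[of t] s_pos[of t0] t
    by (intro mult_mono divide_nonneg_nonneg add_nonneg_nonneg) auto
  finally show "\<bar>w t\<bar> \<le> R_fun t0 a t1 t"
    by (simp add: R_fun_def \<sigma>1_def \<sigma>2_def s_def[abs_def] mult_ac)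
qed (use t in auto)

section \<open>Growth of the dominant solution\<close>

text \<open>Write \<open>F = ln u - S + ln s / 2\<close> and \<open>\<eta> = w / s\<close>, and let \<open>I\<close> be the integral that is assumed bounded. The
Riccati equation gives \<open>(F + \<eta> / 2)' = - w\<^sup>2 / (2 s) - w s' / (2 s\<^sup>2)\<close>. The last term is absorbed by
\<open>I / 2\<close>, and the first one has a sign, which yields the upper bound. For the lower bound the first
term is compensated by \<open>- \<eta>\<^sup>2 / 4\<close>, because \<open>(\<eta>\<^sup>2)' \<le> - 2 w\<^sup>2 / s + O(I')\<close> in view of
\<open>w + 2 s \<ge> s\<close>. So two monotone quantities, each at a bounded distance from \<open>F\<close>, confine \<open>F\<close>.\<close>

lemma wkb_growth:
  assumes K: "\<And>t. t0 \<le> t \<Longrightarrow> \<bar>w t\<bar> \<le> K * s t"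
    and B: "\<And>t. t0 \<le> t \<Longrightarrow> integral {t0..t} (\<lambda>r. \<bar>w r * s' r\<bar> / (s r)^2) \<le> B"
  shows "\<exists>C. \<forall>t\<ge>t0. \<bar>ln (u t) - S t + ln (s t) / 2\<bar> \<le> C"
proof -
  define i where "i r = \<bar>w r * s' r\<bar> / (s r)^2" for r
  define I where "I t = integral {t0..t} i" for t
  define F where "F t = ln (u t) - S t + ln (s t) / 2" for t
  define \<eta> where "\<eta> t = w t / s t" for t
  have K0: "0 \<le> K" using K[of t0] s_pos[of t0] by (simp add: w_init zero_le_mult_iff)
  have i_nonneg: "0 \<le> i r" for r by (simp add: i_def)
  have i_cont: "continuous_on {t0..} i"
    unfolding i_def using s_pos by (intro continuous_intros w_cont s_cont s'_cont) force
  have I_deriv: "(I has_real_derivative i t) (at t within {t0..})" if "t0 \<le> t" for t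
    unfolding I_def[abs_def] by (rule integral_has_real_derivative_ray[OF i_cont that])
  have I0: "I t0 = 0" by (simp add: I_def)
  have I: "0 \<le> I t" "I t \<le> B" if "t0 \<le> t" for t
    using ray_deriv_nonneg_imp_mono[OF I_deriv, of t0 t] that i_nonneg I0 B[OF that]
    by (auto simp: I_def i_def[abs_def])
  have \<eta>: "\<bar>\<eta> t\<bar> \<le> K" if "t0 \<le> t" for t
    using K[OF that] s_pos[OF that] by (simp add: \<eta>_def field_simps)
  have \<eta>0: "\<eta> t0 = 0" by (simp add: \<eta>_def w_init)
  define X where "X r = w r * s' r / (s r)^2" for r
  define Y where "Y r = (w r)^2 / s r" for r
  define Z where "Z r = (w r)^2 * (w r + 2 * s r) / (s r)^2" for r
  have X: "- i r \<le> X r" "X r \<le> i r" for r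
  proof -
    have "\<bar>X r\<bar> = i r" by (simp add: X_def i_def)
    then show "- i r \<le> X r" "X r \<le> i r" by linarith+
  qed
  have Y_nonneg: "0 \<le> Y r" if "t0 \<le> r" for r
    using s_pos[OF that] by (simp add: Y_def)
  have Y_le_Z: "Y r \<le> Z r" if r: "t0 \<le> r" for r
  proof -
    have "Y r = (w r)^2 * s r / (s r)^2" by (simp add: Y_def power2_eq_square)
    also have "\<dots> \<le> Z r" unfolding Z_def
      using w_ge[OF r] by (intro divide_right_mono mult_left_mono) auto
    finally show ?thesis .
  qed
  have \<eta>X: "- (K * i r) \<le> \<eta> r * X r" if r: "t0 \<le> r" for r
  proof -
    have "\<bar>X r\<bar> \<le> i r" using X[of r] by linarith
    then have "\<bar>\<eta> r * X r\<bar> \<le> K * i r"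
      unfolding abs_mult using \<eta>[OF r] K0 by (intro mult_mono) auto
    then show ?thesis by linarith
  qed
  have H_deriv: "((\<lambda>t. F t + \<eta> t / 2) has_real_derivative - (Y t + X t) / 2) (at t within {t0..})"
    if t: "t0 \<le> t" for t
  proof -
    have ln_u: "((\<lambda>t. ln (u t)) has_real_derivative w t + s t) (at t within {t0..})"
      using DERIV_chain2[OF DERIV_ln_divide[OF u_pos[OF t]] u_deriv[OF t]] by (simp add: w_def)
    have ln_s: "((\<lambda>t. ln (s t)) has_real_derivative 1 / s t * s' t) (at t within {t0..})"
      by (rule DERIV_chain2[OF DERIV_ln_divide[OF s_pos[OF t]] s_deriv[OF t]])
    have s0: "s t \<noteq> 0" using s_pos[OF t] by simp
    have "(w t + s t) - s t + 1 / s t * s' t / 2 +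
        (((- w t * (w t + 2 * s t) - s' t) * s t - w t * s' t) / (s t * s t)) / 2 = - (Y t + X t) / 2"
      unfolding X_def Y_def using s0 by (simp add: divide_simps) (simp add: algebra_simps power2_eq_square)
    moreover have "((\<lambda>t. F t + \<eta> t / 2) has_real_derivative (w t + s t) - s t + 1 / s t * s' t / 2 +
        (((- w t * (w t + 2 * s t) - s' t) * s t - w t * s' t) / (s t * s t)) / 2) (at t within {t0..})"
      unfolding F_def \<eta>_def
      by (intro DERIV_add DERIV_diff DERIV_cdivide DERIV_divide ln_u ln_s S_deriv w_deriv s_deriv t s0)
    ultimately show ?thesis by (simp only:)
  qed
  have \<eta>2_deriv: "((\<lambda>t. (\<eta> t)^2) has_real_derivative - 2 * (Z t + X t + \<eta> t * X t)) (at t within {t0..})"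
    if t: "t0 \<le> t" for t
  proof -
    have s0: "s t \<noteq> 0" using s_pos[OF t] by simp
    have "(\<eta> has_real_derivative ((- w t * (w t + 2 * s t) - s' t) * s t - w t * s' t) / (s t * s t))
        (at t within {t0..})"
      unfolding \<eta>_def by (intro DERIV_divide w_deriv s_deriv t s0)
    from DERIV_power[OF this, of 2] have "((\<lambda>t. (\<eta> t)^2) has_real_derivative
        2 * (((- w t * (w t + 2 * s t) - s' t) * s t - w t * s' t) / (s t * s t) * \<eta> t)) (at t within {t0..})"
      by (simp only: of_nat_numeral diff_Suc_1 numeral_2_eq_2 power_one_right) simp
    moreover have "2 * (((- w t * (w t + 2 * s t) - s' t) * s t - w t * s' t) / (s t * s t) * \<eta> t) =
        - 2 * (Z t + X t + \<eta> t * X t)"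
      unfolding X_def Z_def \<eta>_def using s0
      by (simp add: divide_simps) (simp add: algebra_simps power2_eq_square)
    ultimately show ?thesis by (simp only:)
  qed
  have upper: "F t \<le> F t0 + B / 2 + K / 2" if t: "t0 \<le> t" for t
  proof -
    have "I t0 / 2 - (F t0 + \<eta> t0 / 2) \<le> I t / 2 - (F t + \<eta> t / 2)"
    proof (rule ray_deriv_nonneg_imp_mono[OF _ _ t, where f = "\<lambda>t. I t / 2 - (F t + \<eta> t / 2)"])
      fix r assume r: "t0 \<le> r"
      show "((\<lambda>t. I t / 2 - (F t + \<eta> t / 2)) has_real_derivative i r / 2 - (- (Y r + X r) / 2))
          (at r within {t0..})"
        by (intro DERIV_diff DERIV_cdivide I_deriv H_deriv r)
    next
      fix r assume r: "t0 < r"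
      then show "0 \<le> i r / 2 - (- (Y r + X r) / 2)"
        using Y_nonneg[of r] X[of r] by auto
    qed simp
    then show ?thesis using I(2)[OF t] \<eta>[OF t] unfolding I0 \<eta>0 by linarith
  qed
  have lower: "F t0 - (1 + K / 2) * B - K / 2 \<le> F t" if t: "t0 \<le> t" for t
  proof -
    let ?G = "\<lambda>t. (F t + \<eta> t / 2) - (\<eta> t)^2 / 4 + (1 + K / 2) * I t"
    have "?G t0 \<le> ?G t"
    proof (rule ray_deriv_nonneg_imp_mono[OF _ _ t, where f = ?G])
      fix r assume r: "t0 \<le> r"
      show "(?G has_real_derivative - (Y r + X r) / 2 - (- 2 * (Z r + X r + \<eta> r * X r)) / 4
          + (1 + K / 2) * i r) (at r within {t0..})"
        by (intro DERIV_add DERIV_diff DERIV_cdivide DERIV_cmult I_deriv H_deriv \<eta>2_deriv r)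
    next
      fix r assume r: "t0 < r"
      have "(1 + K / 2) * i r = i r + K * i r / 2" by (simp add: distrib_right)
      then show "0 \<le> - (Y r + X r) / 2 - (- 2 * (Z r + X r + \<eta> r * X r)) / 4 + (1 + K / 2) * i r"
        using Y_le_Z[OF less_imp_le[OF r]] \<eta>X[OF less_imp_le[OF r]] X[of r] i_nonneg[of r]
        by (simp add: field_simps)
    qed simp
    moreover have "(1 + K / 2) * I t \<le> (1 + K / 2) * B" using I[OF t] K0 by (intro mult_left_mono) auto
    moreover have "?G t0 = F t0" by (simp add: I0 \<eta>0)
    ultimately show ?thesis using \<eta>[OF t] zero_le_power2[of "\<eta> t"] by linarith
  qed
  show ?thesis
  proof (intro exI allI impI)
    fix t assume t: "t0 \<le> t"
    show "\<bar>ln (u t) - S t + ln (s t) / 2\<bar> \<le> \<bar>F t0\<bar> + (1 + K / 2) * B + K / 2 + B / 2"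
    proof -
      have "0 \<le> B" using I[of t0] by simp
      moreover have "0 \<le> K / 2 * B" using K0 calculation by simp
      moreover have "(1 + K / 2) * B = B + K / 2 * B" by (simp add: distrib_right)
      ultimately show ?thesis using upper[OF t] lower[OF t] K0 unfolding F_def by linarith
    qed
  qed
qed

lemma a_powr_three_halves:
  assumes "t0 \<le> t"
  shows "a t powr (3/2) = s t * (s t)^2"
  using a_pos[OF assms] powr_add[of "a t" 1 "1/2"]
  by (simp add: s_square[OF assms] s_def powr_half_sqrt)

text \<open>The boundedness of \<open>a' / a\<close> makes a constant a barrier for \<open>w\<close>, and \<open>s\<close> is bounded away from \<open>0\<close>; the
integrability comes from \<open>\<bar>w\<bar> \<le> \<rho>\<close> and \<open>s' / s\<^sup>2 = a' / (2 a\<^sup>3\<^sup>/\<^sup>2)\<close>.\<close>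

lemma wkb_growth_integrable:
  assumes \<epsilon>: "0 < \<epsilon>" "\<And>t. t0 \<le> t \<Longrightarrow> \<epsilon> \<le> a t"
    and M: "\<And>t. t0 \<le> t \<Longrightarrow> \<bar>a' t\<bar> \<le> M * a t"
    and int: "(\<lambda>r. rho t0 a r * (\<bar>a' r\<bar> / a r powr (3/2))) integrable_on {t0..}"
  shows "\<exists>C. \<forall>t\<ge>t0. \<bar>ln (u t) - S t + ln (s t) / 2\<bar> \<le> C"
proof (rule wkb_growth)
  have M0: "0 \<le> M" using M[of t0] a_pos[of t0]
    by (smt (verit) mult_nonneg_nonneg zero_le_mult_iff)
  have s': "\<bar>s' t\<bar> \<le> M / 2 * s t" if "t0 \<le> t" for t
  proof -
    have "\<bar>s' t\<bar> = \<bar>a' t\<bar> / (2 * s t)" using s_pos[OF that] by (simp add: s'_def)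
    also have "\<dots> \<le> M * (s t)^2 / (2 * s t)"
      using M[OF that] s_pos[OF that] by (intro divide_right_mono) (auto simp: s_square that)
    also have "\<dots> = M / 2 * s t" by (simp add: power2_eq_square)
    finally show ?thesis .
  qed
  show "\<bar>w t\<bar> \<le> M / 2 / sqrt \<epsilon> * s t" if t: "t0 \<le> t" for t
  proof -
    have "\<bar>w t\<bar> \<le> M / 2"
      using w_bound_step[of t0 t "M / 2"] s' t by (simp add: w_init)
    also have "\<dots> = M / 2 / sqrt \<epsilon> * sqrt \<epsilon>" using \<epsilon>(1) by simp
    also have "\<dots> \<le> M / 2 / sqrt \<epsilon> * s t"
      using M0 \<epsilon>(1) \<epsilon>(2)[OF t] by (intro mult_left_mono) (auto simp: s_def)
    finally show ?thesis .
  qed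
  let ?f = "\<lambda>r. rho t0 a r * (\<bar>a' r\<bar> / a r powr (3/2))"
  have f: "\<bar>w r * s' r\<bar> / (s r)^2 \<le> ?f r" if r: "t0 \<le> r" for r
  proof -
    have "\<bar>w r * s' r\<bar> / (s r)^2 = \<bar>w r\<bar> * (\<bar>a' r\<bar> / (2 * (s r * (s r)^2)))"
      using s_pos[OF r] by (simp add: abs_mult s'_def)
    also have "\<dots> \<le> rho t0 a r * (\<bar>a' r\<bar> / (s r * (s r)^2))"
    proof (rule mult_mono[OF w_le_rho[OF r]])
      have "0 < s r * (s r)^2" using s_pos[OF r] by simp
      then show "\<bar>a' r\<bar> / (2 * (s r * (s r)^2)) \<le> \<bar>a' r\<bar> / (s r * (s r)^2)"
        by (intro frac_le) auto
    qed (use w_le_rho[OF r] s_pos[OF r] in auto)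
    finally show ?thesis unfolding a_powr_three_halves[OF r] .
  qed
  have f_nonneg: "0 \<le> ?f r" if "t0 \<le> r" for r
    by (rule order.trans[OF _ f[OF that]]) simp
  show "integral {t0..t} (\<lambda>r. \<bar>w r * s' r\<bar> / (s r)^2) \<le> integral {t0..} ?f" if t: "t0 \<le> t" for t
  proof -
    have cont: "continuous_on {t0..} (\<lambda>r. \<bar>w r * s' r\<bar> / (s r)^2)"
      using s_pos by (intro continuous_intros w_cont s_cont s'_cont) force
    have int_t: "?f integrable_on {t0..t}"
      by (rule integrable_on_subinterval[OF int]) auto
    have "integral {t0..t} (\<lambda>r. \<bar>w r * s' r\<bar> / (s r)^2) \<le> integral {t0..t} ?f"
      by (rule integral_le[OF integrable_continuous_real[OF continuous_on_subset[OF cont]] int_t f])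
        auto
    also have "\<dots> \<le> integral {t0..} ?f"
      using f_nonneg by (intro integral_subset_le int_t int) auto
    finally show ?thesis .
  qed
qed

lemma a_powr_deriv:
  assumes "t0 \<le> t"
  shows "((\<lambda>t. a t powr e) has_real_derivative e * a t powr (e - 1) * a' t) (at t within {t0..})"
  by (rule DERIV_chain2[OF has_real_derivative_powr[OF a_pos[OF assms]] a_deriv[OF assms]])

text \<open>The exponent may be made small because \<open>a \<ge> a t0 > 0\<close>. With \<open>\<delta> < 1/2\<close> the barrier \<open>a\<^sup>1\<^sup>/\<^sup>2\<^sup>-\<^sup>\<delta>\<close> used
below is nondecreasing.\<close>

lemma powr_bound_shrink_exponent:
  fixes \<epsilon> M :: real
  assumes mono: "mono_on {t0..} a" and \<epsilon>: "0 < \<epsilon>"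
    and M: "\<And>t. t0 \<le> t \<Longrightarrow> a' t \<le> M * a t powr (3/2 - \<epsilon>)"
  obtains \<delta> N where "0 < \<delta>" "\<delta> < 1/2" "0 \<le> N" "\<And>t. t0 \<le> t \<Longrightarrow> a' t \<le> N * a t powr (3/2 - \<delta>)"
proof (rule that)
  let ?\<delta> = "min \<epsilon> (1/4)"
  let ?N = "\<bar>M\<bar> * a t0 powr (?\<delta> - \<epsilon>)"
  show "0 < ?\<delta>" "?\<delta> < 1/2" "0 \<le> ?N" using \<epsilon> by auto
  fix t assume t: "t0 \<le> t"
  have a: "0 < a t0" "a t0 \<le> a t" using a_pos mono_onD[OF mono] t by auto
  have "a' t \<le> \<bar>M\<bar> * a t powr (3/2 - \<epsilon>)"
    by (rule order.trans[OF M[OF t]]) (simp add: mult_right_mono)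
  also have "\<dots> = \<bar>M\<bar> * a t powr (?\<delta> - \<epsilon>) * a t powr (3/2 - ?\<delta>)"
    by (simp add: powr_add[symmetric])
  also have "\<dots> \<le> ?N * a t powr (3/2 - ?\<delta>)"
    using a by (intro mult_right_mono mult_left_mono powr_mono2') auto
  finally show "a' t \<le> ?N * a t powr (3/2 - ?\<delta>)" .
qed

text \<open>As \<open>s' \<ge> 0\<close>, zero is an upper barrier for \<open>w\<close>. The function \<open>g = (N / 2) a\<^sup>1\<^sup>/\<^sup>2\<^sup>-\<^sup>\<delta>\<close> satisfies \<open>s' \<le> s g\<close> and
\<open>g' \<ge> 0\<close>, so \<open>- g\<close> is a lower barrier. The resulting bound for \<open>\<bar>w s'\<bar> / s\<^sup>2\<close> has the
primitive \<open>G\<close> below, which is nonpositive and nondecreasing.\<close>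

lemma wkb_growth_monotone:
  assumes mono: "mono_on {t0..} a" and \<epsilon>: "0 < \<epsilon>"
    and M: "\<And>t. t0 \<le> t \<Longrightarrow> a' t \<le> M * a t powr (3/2 - \<epsilon>)"
  shows "\<exists>C. \<forall>t\<ge>t0. \<bar>ln (u t) - S t + ln (s t) / 2\<bar> \<le> C"
proof -
  obtain \<delta> N where \<delta>: "0 < \<delta>" "\<delta> < 1/2" and N: "0 \<le> N"
    and a'_le: "\<And>t. t0 \<le> t \<Longrightarrow> a' t \<le> N * a t powr (3/2 - \<delta>)"
    using powr_bound_shrink_exponent[OF mono \<epsilon> M] by blast
  have a'_nonneg: "0 \<le> a' t" if t: "t0 < t" for t
  proof (rule mono_on_imp_deriv_nonneg[OF mono])
    show int: "t \<in> interior {t0..}" using t by simp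
    show "(a has_real_derivative a' t) (at t)"
      using a_deriv[of t] t at_within_interior[OF int] by simp
  qed
  define g where "g t = N / 2 * a t powr (1/2 - \<delta>)" for t
  define g' where "g' t = N / 2 * ((1/2 - \<delta>) * a t powr (1/2 - \<delta> - 1) * a' t)" for t
  have g_deriv: "(g has_real_derivative g' t) (at t within {t0..})" if "t0 \<le> t" for t
    unfolding g_def g'_def by (intro DERIV_cmult a_powr_deriv that)
  have g'_nonneg: "0 \<le> g' t" if "t0 < t" for t
    using N \<delta> a'_nonneg[OF that] by (simp add: g'_def)
  have sg: "s' t \<le> s t * g t" if t: "t0 \<le> t" for t
  proof -
    have "s' t \<le> N * a t powr (3/2 - \<delta>) / (2 * s t)"
      using a'_le[OF t] s_pos[OF t] by (auto simp: s'_def intro!: divide_right_mono)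
    also have "a t powr (3/2 - \<delta>) = s t * s t * a t powr (1/2 - \<delta>)"
      using a_pos[OF t] powr_add[of "a t" 1 "1/2 - \<delta>"] s_square[OF t] by (simp add: power2_eq_square)
    also have "N * (s t * s t * a t powr (1/2 - \<delta>)) / (2 * s t) = s t * g t"
      using s_pos[OF t] by (simp add: g_def)
    finally show ?thesis .
  qed
  have w_nonpos: "w t \<le> 0" if t: "t0 \<le> t" for t
  proof -
    have "w t * (u t * exp (S t)) \<le> w t0 * (u t0 * exp (S t0))"
    proof (rule gronwall_weighted[OF w_deriv _ t])
      fix r assume r: "t0 < r"
      then have "0 \<le> s' r" using a'_nonneg[of r] s_pos[of r] by (simp add: s'_def)
      then show "- w r * (w r + 2 * s r) - s' r \<le> - (w r + 2 * s r) * w r" by (simp add: algebra_simps)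
    qed auto
    then have "w t * (u t * exp (S t)) \<le> 0" by (simp add: w_init)
    then show ?thesis using u_pos[OF t] by (simp add: mult_le_0_iff)
  qed
  have w_ge_g: "- g t \<le> w t" if t: "t0 \<le> t" for t
  proof -
    have "(- w t - g t) * (u t * exp (S t)) \<le> (- w t0 - g t0) * (u t0 * exp (S t0))"
    proof (rule gronwall_weighted[where z = "\<lambda>t. - w t - g t", OF _ _ t])
      fix r assume r: "t0 \<le> r"
      show "((\<lambda>t. - w t - g t) has_real_derivative - (- w r * (w r + 2 * s r) - s' r) - g' r)
          (at r within {t0..})"
        by (intro DERIV_diff DERIV_minus w_deriv g_deriv r)
    next
      fix r assume r: "t0 < r"
      have "s' r \<le> s r * g r" using sg r by simp
      also have "\<dots> \<le> (w r + 2 * s r) * g r"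
        using w_ge[of r] r N by (intro mult_right_mono) (auto simp: g_def)
      finally have "s' r \<le> (w r + 2 * s r) * g r" .
      then show "- (- w r * (w r + 2 * s r) - s' r) - g' r \<le> - (w r + 2 * s r) * (- w r - g r)"
        using g'_nonneg[OF r] by (simp add: algebra_simps)
    qed auto
    also have "\<dots> \<le> 0" using N by (simp add: w_init u_init g_def)
    finally show ?thesis using u_pos[OF t] by (simp add: mult_le_0_iff)
  qed
  show ?thesis
  proof (rule wkb_growth[where K = 1])
    show "\<bar>w t\<bar> \<le> 1 * s t" if "t0 \<le> t" for t
      using w_nonpos[OF that] w_ge[OF that] by simp
    define G where "G t = - (N / (4 * \<delta>)) * a t powr (- \<delta>)" for t
    have G_deriv: "(G has_real_derivative N / 4 * (a t powr (- \<delta> - 1) * a' t)) (at t within {t0..})"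
      if t: "t0 \<le> t" for t
      using DERIV_cmult[OF a_powr_deriv[OF t, of "- \<delta>"], of "- (N / (4 * \<delta>))"] \<delta>
      by (simp add: G_def[abs_def])
    have i_cont: "continuous_on {t0..} (\<lambda>r. \<bar>w r * s' r\<bar> / (s r)^2)"
      using s_pos by (intro continuous_intros w_cont s_cont s'_cont) force
    have i_le: "\<bar>w r * s' r\<bar> / (s r)^2 \<le> N / 4 * (a r powr (- \<delta> - 1) * a' r)" if r: "t0 < r" for r
    proof -
      have r': "t0 \<le> r" using r by simp
      have powr: "a r powr (1/2 - \<delta>) = a r powr (- \<delta> - 1) * (s r * (s r)^2)"
        by (simp add: a_powr_three_halves[OF r', symmetric] powr_add[symmetric])
      have "\<bar>w r * s' r\<bar> / (s r)^2 = \<bar>w r\<bar> * (a' r / (2 * (s r * (s r)^2)))"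
        using s_pos[OF r'] a'_nonneg[OF r] by (simp add: abs_mult s'_def)
      also have "\<dots> \<le> g r * (a' r / (2 * (s r * (s r)^2)))"
        using w_nonpos[OF r'] w_ge_g[OF r'] s_pos[OF r'] a'_nonneg[OF r]
        by (intro mult_right_mono) auto
      also have "\<dots> = N / 4 * (a r powr (- \<delta> - 1) * a' r)"
        using s_pos[OF r'] by (simp add: g_def powr)
      finally show ?thesis .
    qed
    show "integral {t0..t} (\<lambda>r. \<bar>w r * s' r\<bar> / (s r)^2) \<le> - G t0" if t: "t0 \<le> t" for t
    proof -
      let ?J = "\<lambda>t. integral {t0..t} (\<lambda>r. \<bar>w r * s' r\<bar> / (s r)^2)"
      have "G t0 - ?J t0 \<le> G t - ?J t"
      proof (rule ray_deriv_nonneg_imp_mono[OF _ _ t, where f = "\<lambda>t. G t - ?J t"])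
        fix r assume r: "t0 \<le> r"
        show "((\<lambda>t. G t - ?J t) has_real_derivative
            N / 4 * (a r powr (- \<delta> - 1) * a' r) - \<bar>w r * s' r\<bar> / (s r)^2) (at r within {t0..})"
          by (intro DERIV_diff G_deriv integral_has_real_derivative_ray i_cont r)
      qed (use i_le in auto)
      moreover have "G t \<le> 0" using N \<delta> by (simp add: G_def)
      ultimately show ?thesis by simp
    qed
  qed
qed

end

section \<open>Complex solutions and the normal form\<close>

text \<open>For a real solution \<open>x\<close> and a large constant \<open>C\<close>, both \<open>C u + x\<close> and \<open>C u - x\<close> satisfy the initial
conditions under which solutions stay positive. As \<open>a\<close> is real, this applies to the real and imaginary
parts of a complex solution.\<close>

lemma solution_bounded_by_growing_solution:
  fixes u v a :: "real \<Rightarrow> real" and z z' :: "real \<Rightarrow> complex"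
  assumes a: "\<And>t. t0 \<le> t \<Longrightarrow> 0 \<le> a t"
    and u: "\<And>t. t0 \<le> t \<Longrightarrow> (u has_real_derivative v t) (at t within {t0..})"
    and v: "\<And>t. t0 \<le> t \<Longrightarrow> (v has_real_derivative a t * u t) (at t within {t0..})"
    and init: "0 < u t0" "0 < v t0"
    and z: "\<And>t. t0 \<le> t \<Longrightarrow> (z has_vector_derivative z' t) (at t within {t0..})"
    and z': "\<And>t. t0 \<le> t \<Longrightarrow> (z' has_vector_derivative a t * z t) (at t within {t0..})"
  shows "\<exists>C>0. \<forall>t\<ge>t0. norm (z t) \<le> C * u t"
proof -
  have real: "\<exists>C>0. \<forall>t\<ge>t0. \<bar>x t\<bar> \<le> C * u t"
    if x: "\<And>t. t0 \<le> t \<Longrightarrow> (x has_real_derivative x' t) (at t within {t0..})"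
    and x': "\<And>t. t0 \<le> t \<Longrightarrow> (x' has_real_derivative a t * x t) (at t within {t0..})"
    for x x' :: "real \<Rightarrow> real"
  proof (intro exI conjI allI impI)
    \<comment> \<open>The summand \<open>1\<close> makes the initial value strictly positive even if \<open>x t0 = 0\<close>.\<close>
    let ?C = "(\<bar>x t0\<bar> + 1) / u t0 + \<bar>x' t0\<bar> / v t0"
    show C: "0 < ?C" by (rule add_pos_nonneg[OF divide_pos_pos]) (use init in auto)
    have Cu: "\<bar>x t0\<bar> + 1 \<le> ?C * u t0" and Cv: "\<bar>x' t0\<bar> \<le> ?C * v t0"
    proof -
      have "(\<bar>x t0\<bar> + 1) / u t0 * u t0 = \<bar>x t0\<bar> + 1" "\<bar>x' t0\<bar> / v t0 * v t0 = \<bar>x' t0\<bar>"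
        using init by simp_all
      moreover have "0 \<le> \<bar>x' t0\<bar> / v t0 * u t0" "0 \<le> (\<bar>x t0\<bar> + 1) / u t0 * v t0"
        using init by simp_all
      ultimately show "\<bar>x t0\<bar> + 1 \<le> ?C * u t0" "\<bar>x' t0\<bar> \<le> ?C * v t0"
        unfolding distrib_right by linarith+
    qed
    fix t assume t: "t0 \<le> t"
    have "0 < ?C * u t + e * x t" if e: "\<bar>e\<bar> = 1" for e
    proof (rule positive_solution(1)[where u = "\<lambda>t. ?C * u t + e * x t" and v = "\<lambda>t. ?C * v t + e * x' t"
          and a = a, OF _ _ a _ _ t])
      fix r assume r: "t0 \<le> r"
      show "((\<lambda>t. ?C * u t + e * x t) has_real_derivative ?C * v r + e * x' r) (at r within {t0..})"
        by (intro DERIV_add DERIV_cmult u x r)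
      have "((\<lambda>t. ?C * v t + e * x' t) has_real_derivative ?C * (a r * u r) + e * (a r * x r)) (at r within {t0..})"
        by (intro DERIV_add DERIV_cmult v x' r)
      then show "((\<lambda>t. ?C * v t + e * x' t) has_real_derivative a r * (?C * u r + e * x r)) (at r within {t0..})"
        by (simp add: algebra_simps)
    next
      have "\<bar>e * y\<bar> = \<bar>y\<bar>" for y using e by (simp add: abs_mult)
      from this[of "x t0"] this[of "x' t0"] Cu Cv
      show "0 < ?C * u t0 + e * x t0" "0 \<le> ?C * v t0 + e * x' t0" by linarith+
    qed
    from this[of 1] this[of "-1"] show "\<bar>x t\<bar> \<le> ?C * u t" by simp
  qed
  have "\<exists>C>0. \<forall>t\<ge>t0. \<bar>Re (z t)\<bar> \<le> C * u t"
  proof (rule real[where x = "\<lambda>t. Re (z t)" and x' = "\<lambda>t. Re (z' t)"])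
    fix t assume t: "t0 \<le> t"
    show "((\<lambda>t. Re (z t)) has_real_derivative Re (z' t)) (at t within {t0..})"
      using bounded_linear.has_vector_derivative[OF bounded_linear_Re z[OF t]]
      by (simp add: has_real_derivative_iff_has_vector_derivative)
    show "((\<lambda>t. Re (z' t)) has_real_derivative a t * Re (z t)) (at t within {t0..})"
      using bounded_linear.has_vector_derivative[OF bounded_linear_Re z'[OF t]]
      by (simp add: has_real_derivative_iff_has_vector_derivative)
  qed
  moreover have "\<exists>C>0. \<forall>t\<ge>t0. \<bar>Im (z t)\<bar> \<le> C * u t"
  proof (rule real[where x = "\<lambda>t. Im (z t)" and x' = "\<lambda>t. Im (z' t)"])
    fix t assume t: "t0 \<le> t"
    show "((\<lambda>t. Im (z t)) has_real_derivative Im (z' t)) (at t within {t0..})"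
      using bounded_linear.has_vector_derivative[OF bounded_linear_Im z[OF t]]
      by (simp add: has_real_derivative_iff_has_vector_derivative)
    show "((\<lambda>t. Im (z' t)) has_real_derivative a t * Im (z t)) (at t within {t0..})"
      using bounded_linear.has_vector_derivative[OF bounded_linear_Im z'[OF t]]
      by (simp add: has_real_derivative_iff_has_vector_derivative)
  qed
  ultimately obtain A B where "0 < A" "0 < B" and AB: "\<And>t. t0 \<le> t \<Longrightarrow> \<bar>Re (z t)\<bar> \<le> A * u t"
    "\<And>t. t0 \<le> t \<Longrightarrow> \<bar>Im (z t)\<bar> \<le> B * u t" by blast
  show ?thesis
  proof (intro exI conjI allI impI)
    show "0 < A + B" using \<open>0 < A\<close> \<open>0 < B\<close> by simp
    fix t assume "t0 \<le> t"
    with AB[of t] cmod_le[of "z t"] show "norm (z t) \<le> (A + B) * u t" by (simp add: distrib_right)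
  qed
qed

text \<open>The factor that removes the first-order term: \<open>\<phi>\<close> solves \<open>\<phi>'' + p \<phi>' + q \<phi> = 0\<close> if and only if
\<open>\<phi> exp (\<integral> p / 2)\<close> solves \<open>\<psi>'' = (p' / 2 + p\<^sup>2 / 4 - q) \<psi>\<close>.\<close>

definition half_exp :: "real \<Rightarrow> (real \<Rightarrow> complex) \<Rightarrow> real \<Rightarrow> complex" where
  "half_exp t0 p t = exp (integral {t0..t} p / 2)"

lemma half_exp_deriv:
  assumes "continuous_on {t0..} p" "t0 \<le> t"
  shows "(half_exp t0 p has_vector_derivative p t / 2 * half_exp t0 p t) (at t within {t0..})"
proof -
  have "((\<lambda>t. integral {t0..t} p / 2) has_vector_derivative p t / 2) (at t within {t0..})"
    using bounded_linear.has_vector_derivative[OF bounded_linear_divide integral_has_vector_derivative_ray[OF assms]] .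
  from field_vector_diff_chain_within[OF this, of exp "exp (integral {t0..t} p / 2)"]
  show ?thesis unfolding half_exp_def[abs_def]
    by (auto simp: o_def DERIV_subset[OF DERIV_exp])
qed

lemma norm_half_exp:
  assumes "continuous_on {t0..} p" "t0 \<le> t"
  shows "norm (half_exp t0 p t) = exp (integral {t0..t} (\<lambda>r. Re (p r)) / 2)"
proof -
  have "p integrable_on {t0..t}"
    by (intro integrable_continuous_real continuous_on_subset[OF assms(1)]) auto
  from integral_linear[OF this bounded_linear_Re]
  show ?thesis by (simp add: half_exp_def norm_exp_eq_Re o_def)
qed

locale normal_form =
  fixes t0 :: real and p q :: "real \<Rightarrow> complex" and a :: "real \<Rightarrow> real"
  assumes p_C1: "C1_on_ray t0 p"
    and a_eq: "t0 \<le> t \<Longrightarrow> complex_of_real (a t) = ray_deriv t0 p t / 2 + (p t / 2)^2 - q t"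
begin

lemma p_cont: "continuous_on {t0..} p"
  unfolding continuous_on_eq_continuous_within
  by (auto intro: has_vector_derivative_continuous[OF C1_on_rayD(1)[OF p_C1]])

lemma half_p_deriv:
  assumes "t0 \<le> t"
  shows "((\<lambda>t. p t / 2) has_vector_derivative ray_deriv t0 p t / 2) (at t within {t0..})"
  using bounded_linear.has_vector_derivative[OF bounded_linear_divide C1_on_rayD(1)[OF p_C1 assms]] .

lemma solution_to_normal_form:
  assumes "is_solution t0 p q \<phi>"
  obtains z' where
    "\<And>t. t0 \<le> t \<Longrightarrow> ((\<lambda>t. \<phi> t * half_exp t0 p t) has_vector_derivative z' t) (at t within {t0..})"
    "\<And>t. t0 \<le> t \<Longrightarrow> (z' has_vector_derivative a t * (\<phi> t * half_exp t0 p t)) (at t within {t0..})"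
proof -
  obtain \<phi>' \<phi>'' where \<phi>: "\<And>t. t0 \<le> t \<Longrightarrow> (\<phi> has_vector_derivative \<phi>' t) (at t within {t0..})"
    "\<And>t. t0 \<le> t \<Longrightarrow> (\<phi>' has_vector_derivative \<phi>'' t) (at t within {t0..})"
    "\<And>t. t0 \<le> t \<Longrightarrow> \<phi>'' t + p t * \<phi>' t + q t * \<phi> t = 0"
    using assms unfolding is_solution_def by blast
  let ?E = "half_exp t0 p"
  note E = half_exp_deriv[OF p_cont]
  show thesis
  proof (rule that[of "\<lambda>t. (\<phi>' t + p t / 2 * \<phi> t) * ?E t"])
    fix t assume t: "t0 \<le> t"
    show "((\<lambda>t. \<phi> t * ?E t) has_vector_derivative (\<phi>' t + p t / 2 * \<phi> t) * ?E t) (at t within {t0..})"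
      using has_vector_derivative_mult[OF \<phi>(1)[OF t] E[OF t]] by (simp add: algebra_simps)
    have "\<phi>'' t = (\<phi>'' t + p t * \<phi>' t + q t * \<phi> t) - 2 * (p t / 2) * \<phi>' t - q t * \<phi> t" by simp
    then have \<phi>'': "\<phi>'' t = - 2 * (p t / 2) * \<phi>' t - q t * \<phi> t" unfolding \<phi>(3)[OF t] by simp
    \<comment> \<open>In terms of \<open>p / 2\<close> and \<open>p' / 2\<close> the claim is an identity of polynomials.\<close>
    define P where "P = p t / 2"
    define P' where "P' = ray_deriv t0 p t / 2"
    have "(\<phi>' t + P * \<phi> t) * (P * ?E t) + (\<phi>'' t + (P * \<phi>' t + P' * \<phi> t)) * ?E t
        = a t * (\<phi> t * ?E t)"
      unfolding a_eq[OF t] \<phi>'' P_def[symmetric] P'_def[symmetric]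
      by (simp add: algebra_simps power2_eq_square)
    then show "((\<lambda>t. (\<phi>' t + p t / 2 * \<phi> t) * ?E t) has_vector_derivative a t * (\<phi> t * ?E t)) (at t within {t0..})"
      using has_vector_derivative_mult[OF has_vector_derivative_add[OF \<phi>(2)[OF t]
        has_vector_derivative_mult[OF half_p_deriv[OF t] \<phi>(1)[OF t]]] E[OF t]]
      by (simp only: P_def P'_def)
  qed
qed

lemma solution_from_normal_form:
  assumes u: "\<And>t. t0 \<le> t \<Longrightarrow> (u has_real_derivative v t) (at t within {t0..})"
    and v: "\<And>t. t0 \<le> t \<Longrightarrow> (v has_real_derivative a t * u t) (at t within {t0..})"
  shows "is_solution t0 p q (\<lambda>t. u t / half_exp t0 p t)"
proof -
  let ?E = "half_exp t0 (\<lambda>t. - p t)"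
  have eq: "(\<lambda>t. u t / half_exp t0 p t) = (\<lambda>t. u t * ?E t)"
    by (simp add: half_exp_def exp_minus field_simps)
  have E: "(?E has_vector_derivative - p t / 2 * ?E t) (at t within {t0..})" if "t0 \<le> t" for t
    by (rule half_exp_deriv) (intro continuous_intros p_cont that)+
  have u': "((\<lambda>t. complex_of_real (u t)) has_vector_derivative v t) (at t within {t0..})" 
    and v': "((\<lambda>t. complex_of_real (v t)) has_vector_derivative a t * u t) (at t within {t0..})" if "t0 \<le> t" for t
    using bounded_linear.has_vector_derivative[OF bounded_linear_of_real, of u "v t"]
      bounded_linear.has_vector_derivative[OF bounded_linear_of_real, of v "a t * u t"]
      u[OF that] v[OF that]
    by (auto simp: has_real_derivative_iff_has_vector_derivative)
  show ?thesis
    unfolding is_solution_def eq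
  proof (intro exI allI impI conjI)
    fix t assume t: "t0 \<le> t"
    show "((\<lambda>t. u t * ?E t) has_vector_derivative (v t - p t / 2 * u t) * ?E t) (at t within {t0..})"
      using has_vector_derivative_mult[OF u'[OF t] E[OF t]] by (simp add: algebra_simps)
    show "((\<lambda>t. (v t - p t / 2 * u t) * ?E t) has_vector_derivative
        (v t - p t / 2 * u t) * (- p t / 2 * ?E t) +
        (a t * u t - (p t / 2 * v t + ray_deriv t0 p t / 2 * u t)) * ?E t) (at t within {t0..})"
      using has_vector_derivative_mult[OF has_vector_derivative_diff[OF v'[OF t]
        has_vector_derivative_mult[OF half_p_deriv[OF t] u'[OF t]]] E[OF t]] by simp
    show "(v t - p t / 2 * u t) * (- p t / 2 * ?E t) +
        (a t * u t - (p t / 2 * v t + ray_deriv t0 p t / 2 * u t)) * ?E t +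
        p t * ((v t - p t / 2 * u t) * ?E t) + q t * (u t * ?E t) = 0"
    proof -
      define P where "P = p t / 2"
      define P' where "P' = ray_deriv t0 p t / 2"
      have P: "- p t / 2 = - P" "p t * ((v t - P * u t) * ?E t) = 2 * P * ((v t - P * u t) * ?E t)"
        by (simp_all add: P_def)
      show ?thesis unfolding of_real_mult a_eq[OF t] P_def[symmetric] P'_def[symmetric] P
        by (simp add: algebra_simps power2_eq_square)
    qed
  qed
qed

end

section \<open>Boundedness and decay of all solutions\<close>

lemma log_comparison_criterion:
  fixes G r :: "real \<Rightarrow> real"
  assumes G: "\<And>t. t0 \<le> t \<Longrightarrow> 0 < G t"
    and B: "\<And>t. t0 \<le> t \<Longrightarrow> \<bar>2 * ln (G t) - r t\<bar> \<le> B"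
  shows "bdd_above (G ` {t0..}) \<longleftrightarrow> bdd_above (r ` {t0..})"
    and "(G \<longlongrightarrow> 0) at_top \<longleftrightarrow> filterlim r at_bot at_top"
proof -
  have r_le: "r t \<le> 2 * ln M + B" if "t0 \<le> t" "G t \<le> M" for t M
  proof -
    have "ln (G t) \<le> ln M" using G[OF that(1)] that(2) by simp
    then show ?thesis using B[OF that(1)] by linarith
  qed
  have G_le: "G t \<le> exp ((Z + B) / 2)" if "t0 \<le> t" "r t \<le> Z" for t Z
  proof -
    have "2 * ln (G t) - r t \<le> B" using B[OF that(1)] by (rule abs_le_D1)
    then have "ln (G t) \<le> (Z + B) / 2" using that(2) by simp
    then have "exp (ln (G t)) \<le> exp ((Z + B) / 2)" by simp
    then show ?thesis using G[OF that(1)] by simp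
  qed
  show "bdd_above (G ` {t0..}) \<longleftrightarrow> bdd_above (r ` {t0..})"
  proof
    assume "bdd_above (G ` {t0..})"
    then obtain M where "\<And>t. t0 \<le> t \<Longrightarrow> G t \<le> M" unfolding bdd_above_def by auto
    then show "bdd_above (r ` {t0..})" using r_le by (intro bdd_aboveI2[where M = "2 * ln M + B"]) auto
  next
    assume "bdd_above (r ` {t0..})"
    then obtain Z where "\<And>t. t0 \<le> t \<Longrightarrow> r t \<le> Z" unfolding bdd_above_def by auto
    then show "bdd_above (G ` {t0..})" using G_le by (intro bdd_aboveI2[where M = "exp ((Z + B) / 2)"]) auto
  qed
  show "(G \<longlongrightarrow> 0) at_top \<longleftrightarrow> filterlim r at_bot at_top"
  proof
    assume lim: "(G \<longlongrightarrow> 0) at_top"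
    show "filterlim r at_bot at_top"
      unfolding filterlim_at_bot
    proof
      fix Z
      have "\<forall>\<^sub>F t in at_top. G t < exp ((Z - B) / 2)"
        by (rule order_tendstoD(2)[OF lim]) simp
      then show "\<forall>\<^sub>F t in at_top. r t \<le> Z"
        using eventually_ge_at_top[of t0]
      proof eventually_elim
        case (elim t)
        then show ?case using r_le[of t "exp ((Z - B) / 2)"] by (simp add: field_simps)
      qed
    qed
  next
    assume lim: "filterlim r at_bot at_top"
    show "(G \<longlongrightarrow> 0) at_top"
    proof (rule order_tendstoI)
      fix e :: real assume "e < 0"
      show "\<forall>\<^sub>F t in at_top. e < G t"
        using eventually_ge_at_top[of t0] by eventually_elim (use G \<open>e < 0\<close> in force)
    next
      fix e :: real assume e: "0 < e"
      have "\<forall>\<^sub>F t in at_top. r t \<le> 2 * ln (e / 2) - B"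
        using lim unfolding filterlim_at_bot by blast
      then show "\<forall>\<^sub>F t in at_top. G t < e"
        using eventually_ge_at_top[of t0]
      proof eventually_elim
        case (elim t)
        then show ?case using G_le[of t "2 * ln (e / 2) - B"] e by simp
      qed
    qed
  qed
qed

theorem theorem2p1:
  fixes t0 :: real and p q :: "real \<Rightarrow> complex" and D :: "real \<Rightarrow> real"
  assumes "continuous_on {t0..} p" and "continuous_on {t0..} q"
    and "C1_on_ray t0 p"
    and "\<And>t. t \<ge> t0 \<Longrightarrow> complex_of_real (D t) = 2 * ray_deriv t0 p t + (p t)^2 - 4 * q t"
    and "\<And>t. t \<ge> t0 \<Longrightarrow> D t > 0"
    and "C1_on_ray t0 D"
    and "condition_B t0 D \<or> condition_C t0 D"
  shows "((\<forall>\<phi>. is_solution t0 p q \<phi> \<longrightarrow> bounded (\<phi> ` {t0..})) \<longleftrightarrow>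
            bdd_above (r1 t0 p D ` {t0..})) \<and>
         ((\<forall>\<phi>. is_solution t0 p q \<phi> \<longrightarrow> (\<phi> \<longlongrightarrow> 0) at_top) \<longleftrightarrow>
            filterlim (r1 t0 p D) at_bot at_top)"
proof -
  note D_pos = assms(5)
  define a where "a = (\<lambda>t. D t / 4)"
  define a' where "a' = (\<lambda>t. ray_deriv t0 D t / 4)"
  have a_deriv: "(a has_real_derivative a' t) (at t within {t0..})" if "t0 \<le> t" for t
    using C1_on_rayD(1)[OF assms(6) that] unfolding a_def a'_def
    by (intro DERIV_cdivide) (simp add: has_real_derivative_iff_has_vector_derivative)
  have a_cont: "continuous_on {t0..} a" using a_deriv by (intro DERIV_continuous_on) auto
  obtain u v where uv: "u t0 = 1" "v t0 = sqrt (a t0)"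
    "\<And>t. t0 \<le> t \<Longrightarrow> (u has_real_derivative v t) (at t within {t0..})"
    "\<And>t. t0 \<le> t \<Longrightarrow> (v has_real_derivative a t * u t) (at t within {t0..})"
    using linear_ode_exists[OF a_cont, of 1 "sqrt (a t0)"] by blast
  interpret growing_solution t0 a a' u v
  proof
    show "continuous_on {t0..} a'"
      unfolding a'_def by (intro continuous_intros C1_on_rayD(2)[OF assms(6)]) auto
  qed (use D_pos a_deriv uv in \<open>auto simp: a_def\<close>)
  interpret normal_form t0 p q a
  proof
    fix t assume "t0 \<le> t"
    from assms(4)[OF this] show "complex_of_real (a t) = ray_deriv t0 p t / 2 + (p t / 2)\<^sup>2 - q t"
      by (simp add: a_def field_simps)
  qed (rule assms(3))
  have D_powr: "D t powr e = 4 powr e * a t powr e" if "t0 \<le> t" for t e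
    using powr_mult[of 4 "a t" e] a_pos[OF that] by (simp add: a_def)
  have "\<exists>C. \<forall>t\<ge>t0. \<bar>ln (u t) - S t + ln (s t) / 2\<bar> \<le> C"
    using assms(7)
  proof
    assume "condition_B t0 D"
    then obtain \<epsilon> M where mono: "mono_on {t0..} D" and \<epsilon>: "0 < \<epsilon>"
      and M: "\<And>t. t0 \<le> t \<Longrightarrow> \<bar>ray_deriv t0 D t / D t powr (3/2 - \<epsilon>)\<bar> \<le> M"
      unfolding condition_B_def bounded_iff by auto
    have bound: "a' t \<le> (M * 4 powr (3/2 - \<epsilon>) / 4) * a t powr (3/2 - \<epsilon>)" if t: "t0 \<le> t" for t
    proof -
      have "ray_deriv t0 D t / D t powr (3/2 - \<epsilon>) \<le> M" using M[OF t] by linarith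
      then have "ray_deriv t0 D t \<le> M * D t powr (3/2 - \<epsilon>)"
        using D_pos[OF t] by (simp add: field_simps)
      then show ?thesis by (simp add: D_powr[OF t] a'_def)
    qed
    have mono_a: "mono_on {t0..} a" using mono by (auto simp: mono_on_def a_def)
    show ?thesis by (rule wkb_growth_monotone[OF mono_a \<epsilon> bound])
  next
    assume "condition_C t0 D"
    then obtain \<epsilon> M where \<epsilon>: "0 < \<epsilon>" "\<And>t. t0 \<le> t \<Longrightarrow> \<epsilon> \<le> D t"
      and M: "\<And>t. t0 \<le> t \<Longrightarrow> \<bar>ray_deriv t0 D t / D t\<bar> \<le> M"
      and int: "(\<lambda>r. rho t0 a r * (\<bar>ray_deriv t0 D r\<bar> / D r powr (3/2))) integrable_on {t0..}"
      unfolding condition_C_def bounded_iff a_def by auto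
    \<comment> \<open>Passing from \<open>D\<close> to \<open>a = D / 4\<close> multiplies the integrand by \<open>4\<^sup>3\<^sup>/\<^sup>2 / 4 = 2\<close>.\<close>
    have four: "(4::real) powr (3/2) = 8"
    proof -
      have "(4::real) powr (3/2) = 4 powr 1 * 4 powr (1/2)" unfolding powr_add[symmetric] by simp
      then show ?thesis by (simp add: powr_half_sqrt)
    qed
    have int_a: "(\<lambda>r. rho t0 a r * (\<bar>a' r\<bar> / a r powr (3/2))) integrable_on {t0..}"
    proof (rule integrable_eq[OF integrable_cmul[OF int, of 2]])
      fix r assume "r \<in> {t0..}"
      then show "2 *\<^sub>R (rho t0 a r * (\<bar>ray_deriv t0 D r\<bar> / D r powr (3/2))) =
          rho t0 a r * (\<bar>a' r\<bar> / a r powr (3/2))"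
        by (simp add: D_powr four a'_def)
    qed
    have bound: "\<bar>a' t\<bar> \<le> M * a t" if "t0 \<le> t" for t
    proof -
      have "\<bar>ray_deriv t0 D t\<bar> / D t \<le> M" using M[OF that] D_pos[OF that] by simp
      then show ?thesis using D_pos[OF that] by (simp add: a_def a'_def pos_divide_le_eq)
    qed
    have \<epsilon>_a: "0 < \<epsilon> / 4" "\<And>t. t0 \<le> t \<Longrightarrow> \<epsilon> / 4 \<le> a t" using \<epsilon> by (auto simp: a_def)
    show ?thesis by (rule wkb_growth_integrable[OF \<epsilon>_a bound int_a])
  qed
  then obtain C where C: "\<And>t. t0 \<le> t \<Longrightarrow> \<bar>ln (u t) - S t + ln (s t) / 2\<bar> \<le> C" by blast
  \<comment> \<open>The modulus of the solution of the original equation that corresponds to \<open>u\<close>.\<close>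
  define G where "G t = u t / norm (half_exp t0 p t)" for t
  have G_pos: "0 < G t" if "t0 \<le> t" for t
    using u_pos[OF that] by (simp add: G_def half_exp_def)
  have G: "\<bar>2 * ln (G t) - r1 t0 p D t\<bar> \<le> 2 * C + ln 4 / 2" if t: "t0 \<le> t" for t
  proof -
    have cont: "continuous_on {t0..t} (\<lambda>r. sqrt (D r))" "continuous_on {t0..t} (\<lambda>r. Re (p r))"
    proof -
      have "continuous_on {t0..t} a" "continuous_on {t0..t} p"
        by (auto intro: continuous_on_subset a_cont p_cont)
      then show "continuous_on {t0..t} (\<lambda>r. sqrt (D r))" "continuous_on {t0..t} (\<lambda>r. Re (p r))"
        using continuous_on_mult_left[of "{t0..t}" a 4] by (auto simp: a_def intro!: continuous_intros)
    qed
    have s: "s = (\<lambda>r. sqrt (D r) / 2)"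
      unfolding s_def[abs_def] by (simp add: a_def real_sqrt_divide)
    have "integral {t0..t} (\<lambda>r. sqrt (D r)) = 2 * S t"
      by (simp add: S_def s)
    moreover have "integral {t0..t} (\<lambda>r. sqrt (D r) - Re (p r)) =
        integral {t0..t} (\<lambda>r. sqrt (D r)) - integral {t0..t} (\<lambda>r. Re (p r))"
      by (intro Henstock_Kurzweil_Integration.integral_diff integrable_continuous_real cont)
    moreover have "ln (s t) = ln (a t) / 2" using a_pos[OF t] by (simp add: s_def ln_sqrt)
    moreover have "ln (a t) = ln (D t) - ln 4" using D_pos[OF t] by (simp add: a_def ln_div)
    moreover have "ln (G t) = ln (u t) - integral {t0..t} (\<lambda>r. Re (p r)) / 2"
      using u_pos[OF t] by (simp add: G_def ln_div norm_half_exp[OF p_cont t])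
    moreover have "0 \<le> ln (4::real)" by simp
    ultimately show ?thesis using C[OF t] unfolding r1_def by linarith
  qed
  have criterion: "bdd_above (r1 t0 p D ` {t0..}) \<longleftrightarrow> bdd_above (G ` {t0..})"
    "filterlim (r1 t0 p D) at_bot at_top \<longleftrightarrow> (G \<longlongrightarrow> 0) at_top"
    using log_comparison_criterion[of t0 G "r1 t0 p D", OF G_pos G] by simp_all
  have sol: "is_solution t0 p q (\<lambda>t. u t / half_exp t0 p t)"
    by (rule solution_from_normal_form[OF u_deriv v_deriv])
  have norm_sol: "norm (u t / half_exp t0 p t) = G t" if "t0 \<le> t" for t
    using u_pos[OF that] by (simp add: G_def norm_divide)
  have le: "\<exists>K>0. \<forall>t\<ge>t0. norm (\<phi> t) \<le> K * G t" if "is_solution t0 p q \<phi>" for \<phi>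
  proof -
    from solution_to_normal_form[OF that] obtain z' where z:
      "\<And>t. t0 \<le> t \<Longrightarrow> ((\<lambda>t. \<phi> t * half_exp t0 p t) has_vector_derivative z' t) (at t within {t0..})"
      "\<And>t. t0 \<le> t \<Longrightarrow> (z' has_vector_derivative a t * (\<phi> t * half_exp t0 p t)) (at t within {t0..})"
      by blast
    have "\<exists>K>0. \<forall>t\<ge>t0. norm (\<phi> t * half_exp t0 p t) \<le> K * u t"
    proof (rule solution_bounded_by_growing_solution[OF _ u_deriv v_deriv _ _ z])
      show "0 \<le> a t" if "t0 \<le> t" for t using a_pos[OF that] by simp
      show "0 < u t0" "0 < v t0" using a_pos by (simp_all add: u_init v_init)
    qed
    then obtain K where K: "0 < K" "\<And>t. t0 \<le> t \<Longrightarrow> norm (\<phi> t * half_exp t0 p t) \<le> K * u t"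
      by blast
    show ?thesis
    proof (intro exI conjI allI impI)
      fix t assume "t0 \<le> t"
      then show "norm (\<phi> t) \<le> K * G t"
        using K(2)[of t] by (simp add: G_def norm_mult half_exp_def field_simps)
    qed (rule K(1))
  qed
  show ?thesis
  proof (intro conjI)
    show "(\<forall>\<phi>. is_solution t0 p q \<phi> \<longrightarrow> bounded (\<phi> ` {t0..})) \<longleftrightarrow> bdd_above (r1 t0 p D ` {t0..})"
      unfolding criterion(1)
    proof (intro iffI allI impI)
      assume "\<forall>\<phi>. is_solution t0 p q \<phi> \<longrightarrow> bounded (\<phi> ` {t0..})"
      with sol have "bounded ((\<lambda>t. u t / half_exp t0 p t) ` {t0..})" by blast
      then show "bdd_above (G ` {t0..})"
        unfolding bounded_iff bdd_above_def by (auto simp: norm_sol)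
    next
      fix \<phi> assume "bdd_above (G ` {t0..})" and \<phi>: "is_solution t0 p q \<phi>"
      then obtain M where M: "\<And>t. t0 \<le> t \<Longrightarrow> G t \<le> M" unfolding bdd_above_def by auto
      obtain K where K: "0 < K" "\<And>t. t0 \<le> t \<Longrightarrow> norm (\<phi> t) \<le> K * G t" using le[OF \<phi>] by blast
      have "norm (\<phi> t) \<le> K * M" if "t0 \<le> t" for t
        using K(2)[OF that] mult_left_mono[OF M[OF that], of K] K(1) by linarith
      then show "bounded (\<phi> ` {t0..})" unfolding bounded_iff by auto
    qed
    show "(\<forall>\<phi>. is_solution t0 p q \<phi> \<longrightarrow> (\<phi> \<longlongrightarrow> 0) at_top) \<longleftrightarrow> filterlim (r1 t0 p D) at_bot at_top"
      unfolding criterion(2)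
    proof (intro iffI allI impI)
      assume "\<forall>\<phi>. is_solution t0 p q \<phi> \<longrightarrow> (\<phi> \<longlongrightarrow> 0) at_top"
      with sol have "((\<lambda>t. u t / half_exp t0 p t) \<longlongrightarrow> 0) at_top" by blast
      then have "((\<lambda>t. norm (u t / half_exp t0 p t)) \<longlongrightarrow> 0) at_top" by (rule tendsto_norm_zero)
      moreover have "\<forall>\<^sub>F t in at_top. norm (u t / half_exp t0 p t) = G t"
        using eventually_ge_at_top[of t0] by eventually_elim (rule norm_sol)
      ultimately show "(G \<longlongrightarrow> 0) at_top" by (rule Lim_transform_eventually)
    next
      fix \<phi> assume lim: "(G \<longlongrightarrow> 0) at_top" and \<phi>: "is_solution t0 p q \<phi>"
      obtain K where K: "\<And>t. t0 \<le> t \<Longrightarrow> norm (\<phi> t) \<le> K * G t" using le[OF \<phi>] by blast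
      show "(\<phi> \<longlongrightarrow> 0) at_top"
      proof (rule Lim_null_comparison)
        show "\<forall>\<^sub>F t in at_top. norm (\<phi> t) \<le> K * G t"
          using eventually_ge_at_top[of t0] by eventually_elim (rule K)
        show "((\<lambda>t. K * G t) \<longlongrightarrow> 0) at_top" by (rule tendsto_mult_right_zero[OF lim])
      qed
    qed
  qed
qed

end
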